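(* Let $d\ge2$, $k\ge2$, let $a$, $a_{hom}$, $\phi$, $\sigma$ be as in the context, and let $P\in\mathcal{P}^k_{a_{hom}}$. Suppose that $\psi_P\in H^1_{loc}(\mathbb{R}^d)$ satisfies $$-\nabla\cdot a\nabla\psi_P=\nabla\cdot\big((\phi_i a-\sigma_i)\nabla\partial_i P\big).$$ Then $$-\nabla\cdot a\nabla\big(P+\phi_i\partial_iP+\psi_P\big)=0.$$
   Context: Setting. $d\ge2$, $\lambda>0$, and $a:\mathbb{R}^d\to\mathbb{R}^{d\times d}$ is a measurable coefficient field with $\lambda|\xi|^2\le\xi\cdot a(x)\xi$ and $|a(x)\xi|\le|\xi|$ for all $\xi\in\mathbb{R}^d$ and a.e. $x$. All equations are understood in the weak (distributional) sense. $e_i$ is the standard basis, repeated indices are summed (Einstein convention). $a_{hom}\in\mathbb{R}^{d\times d}$ is a constant elliptic matrix. Correctors: $\phi_i\in H^1_{loc}(\mathbb{R}^d)$, $1\le i\le d$, satisfies $-\nabla\cdot a(e_i+\nabla\phi_i)=0$ on $\mathbb{R}^d$. With $q_i:=a(e_i+\nabla\phi_i)-a_{hom}e_i$ (components $q_{ij}$), the vector potential $\sigma=(\sigma_{ijk})$, $\sigma_{ijk}\in H^1_{loc}(\mathbb{R}^d)$, is antisymmetric in its last two indices ($\sigma_{ijk}=-\sigma_{ikj}$) and satisfies $\partial_k\sigma_{ijk}=q_{ij}$. $\sigma_i$ denotes the matrix $(\sigma_{ijk})_{jk}$, so $(\sigma_i\nabla w)_j=\sigma_{ijk}\partial_kw$.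 $\mathcal{P}^k_{a_{hom}}$ is the space of homogeneous polynomials $P$ of degree $k$ on $\mathbb{R}^d$ that are $a_{hom}$-harmonic, i.e. $(a_{hom})_{ij}\partial_i\partial_jP=0$. *)

theory Defs
  imports "HOL-Analysis.Analysis"
begin

definition partial_deriv :: "'d \<Rightarrow> (real^'d \<Rightarrow> real) \<Rightarrow> real^'d \<Rightarrow> real" where
  "partial_deriv i f x = frechet_derivative f (at x) (axis i 1)"

definition grad :: "(real^'d \<Rightarrow> real) \<Rightarrow> real^'d \<Rightarrow> real^'d" where
  "grad f x = (\<chi> i. partial_deriv i f x)"

primrec C_diff :: "nat \<Rightarrow> (real^'d \<Rightarrow> real) \<Rightarrow> bool" where
  "C_diff 0 f \<longleftrightarrow> continuous_on UNIV f"
| "C_diff (Suc n) f \<longleftrightarrow> f differentiable_on UNIV \<and> (\<forall>i. C_diff n (partial_deriv i f))"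

definition test_functions :: "(real^'d \<Rightarrow> real) set" where
  "test_functions = {\<eta>. (\<forall>n. C_diff n \<eta>) \<and> compact (closure {x. \<eta> x \<noteq> 0})}"

definition L1_loc :: "(real^'d \<Rightarrow> 'b::euclidean_space) set" where
  "L1_loc = {f. \<forall>K. compact K \<longrightarrow> set_integrable lebesgue K f}"

definition L2_loc :: "(real^'d \<Rightarrow> 'b::euclidean_space) set" where
  "L2_loc = {f. f \<in> borel_measurable lebesgue \<and>
                (\<forall>K. compact K \<longrightarrow> set_integrable lebesgue K (\<lambda>x. (norm (f x))\<^sup>2))}"

definition has_weak_grad :: "(real^'d \<Rightarrow> real) \<Rightarrow> (real^'d \<Rightarrow> real^'d) \<Rightarrow> bool" where
  "has_weak_grad u G \<longleftrightarrow> u \<in> L1_loc \<and> G \<in> L1_loc \<and>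
     (\<forall>\<eta>\<in>test_functions. \<forall>i.
        (LINT x|lebesgue. u x * partial_deriv i \<eta> x) = - (LINT x|lebesgue. G x $ i * \<eta> x))"

(* An arbitrary representative: the weak gradient is determined only up to a null set.
   The value carries no information unless a weak gradient exists. *)
definition weak_grad :: "(real^'d \<Rightarrow> real) \<Rightarrow> real^'d \<Rightarrow> real^'d" where
  "weak_grad u = (SOME G. has_weak_grad u G)"

(* Elements are functions, not classes modulo equality almost everywhere. *)
definition H1_loc :: "(real^'d \<Rightarrow> real) set" where
  "H1_loc = {u \<in> L2_loc. \<exists>G\<in>L2_loc. has_weak_grad u G}"

(* The distribution div F applied to the test function \<eta>. *)
definition weak_div :: "(real^'d \<Rightarrow> real^'d) \<Rightarrow> (real^'d \<Rightarrow> real) \<Rightarrow> real" where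
  "weak_div F \<eta> = - (LINT x|lebesgue. F x \<bullet> grad \<eta> x)"

definition homogeneous_polynomial :: "nat \<Rightarrow> (real^'d \<Rightarrow> real) \<Rightarrow> bool" where
  "homogeneous_polynomial k P \<longleftrightarrow>
     (\<exists>c :: ('d \<Rightarrow> nat) \<Rightarrow> real. \<forall>x.
        P x = (\<Sum>\<alpha> | (\<Sum>i\<in>UNIV. \<alpha> i) = k. c \<alpha> * (\<Prod>i\<in>UNIV. (x $ i) ^ \<alpha> i)))"

definition harmonic_polynomials :: "real^'d^'d \<Rightarrow> nat \<Rightarrow> (real^'d \<Rightarrow> real) set" where
  "harmonic_polynomials A k = {P. homogeneous_polynomial k P \<and>
     (\<forall>x. (\<Sum>i\<in>UNIV. \<Sum>j\<in>UNIV. A $ i $ j * partial_deriv i (partial_deriv j P) x) = 0)}"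

definition elliptic_matrix :: "real^'d^'d \<Rightarrow> bool" where
  "elliptic_matrix A \<longleftrightarrow> (\<exists>\<mu>>0. \<forall>\<xi>. \<mu> * (norm \<xi>)\<^sup>2 \<le> \<xi> \<bullet> (A *v \<xi>))"

definition elliptic_field :: "real \<Rightarrow> (real^'d \<Rightarrow> real^'d^'d) \<Rightarrow> bool" where
  "elliptic_field lam a \<longleftrightarrow> a \<in> borel_measurable lebesgue \<and>
     (AE x in lebesgue. \<forall>\<xi>. lam * (norm \<xi>)\<^sup>2 \<le> \<xi> \<bullet> (a x *v \<xi>) \<and> norm (a x *v \<xi>) \<le> norm \<xi>)"

definition corrector_flux ::
    "(real^'d \<Rightarrow> real^'d^'d) \<Rightarrow> ('d \<Rightarrow> real^'d \<Rightarrow> real) \<Rightarrow> 'd \<Rightarrow> real^'d \<Rightarrow> real^'d" where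
  "corrector_flux a \<phi> i x = a x *v (axis i 1 + weak_grad (\<phi> i) x)"

definition is_corrector ::
    "(real^'d \<Rightarrow> real^'d^'d) \<Rightarrow> ('d \<Rightarrow> real^'d \<Rightarrow> real) \<Rightarrow> bool" where
  "is_corrector a \<phi> \<longleftrightarrow> (\<forall>i. \<phi> i \<in> H1_loc \<and>
     (\<forall>\<eta>\<in>test_functions. - weak_div (corrector_flux a \<phi> i) \<eta> = 0))"

definition is_vector_potential ::
    "(real^'d \<Rightarrow> real^'d^'d) \<Rightarrow> real^'d^'d \<Rightarrow> ('d \<Rightarrow> real^'d \<Rightarrow> real) \<Rightarrow>
     ('d \<Rightarrow> 'd \<Rightarrow> 'd \<Rightarrow> real^'d \<Rightarrow> real) \<Rightarrow> bool" where
  "is_vector_potential a ahom \<phi> \<sigma> \<longleftrightarrow>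
     (\<forall>i j k. \<sigma> i j k \<in> H1_loc) \<and>
     (\<forall>i j k. AE x in lebesgue. \<sigma> i j k x = - \<sigma> i k j x) \<and>
     (\<forall>i j. \<forall>\<eta>\<in>test_functions.
        weak_div (\<lambda>x. \<chi> k. \<sigma> i j k x) \<eta>
          = (LINT x|lebesgue. (corrector_flux a \<phi> i x - ahom *v axis i 1) $ j * \<eta> x))"

end

theory Submission
  imports Defs
begin

text \<open>
Write \<open>u\<close> for the corrected polynomial, \<open>q\<^sub>i = a (e\<^sub>i + \<nabla>\<phi>\<^sub>i) - a\<^sub>h\<^sub>o\<^sub>m e\<^sub>i\<close> for the flux
corrections and \<open>f\<^sub>i = \<partial>\<^sub>i P\<close>. The product rule for weak gradients and \<open>\<nabla>P = f\<^sub>i e\<^sub>i\<close> give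
\<open>a \<nabla>u = f\<^sub>i q\<^sub>i + a\<^sub>h\<^sub>o\<^sub>m \<nabla>P + \<sigma>\<^sub>i \<nabla>f\<^sub>i + (\<phi>\<^sub>i a - \<sigma>\<^sub>i) \<nabla>f\<^sub>i + a \<nabla>\<psi>\<close>.
The last two terms have opposite divergences by the equation for \<open>\<psi>\<close>, and \<open>a\<^sub>h\<^sub>o\<^sub>m \<nabla>P\<close> is
divergence free because \<open>P\<close> is harmonic for \<open>a\<^sub>h\<^sub>o\<^sub>m\<close> (\<open>weak_div_harmonic_eq_0\<close>). The
first and the third term cancel as well: \<open>q\<^sub>i\<close> is the row-wise divergence of the antisymmetric
matrix \<open>\<sigma>\<^sub>i\<close>, so the divergence of \<open>f\<^sub>i q\<^sub>i\<close> is minus that of \<open>\<sigma>\<^sub>i \<nabla>f\<^sub>i\<close>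
(\<open>weak_div_potential\<close>); this rests on the symmetry of second derivatives of test functions
(\<open>partial_deriv_commute\<close>).

Two analytic points make this rigorous. The function \<open>weak_grad u\<close> is an unspecified representative,
so the gradient computed by the product rule has to agree with it almost everywhere. This is the fundamental
lemma of the calculus of variations (\<open>AE_eq_0_if_orthogonal_to_test_functions\<close>), for which smooth bump
functions on boxes are constructed. Moreover \<open>P\<close> itself has to have its classical gradient as weak
gradient, which is integration by parts against test functions (\<open>has_weak_grad_smooth\<close>).
\<close>

section \<open>Smooth functions\<close>

definition smooth :: "(real^'d \<Rightarrow> real) \<Rightarrow> bool" where
  "smooth f \<longleftrightarrow> (\<forall>n. C_diff n f)"

lemma partial_deriv_eqI:
  "(f has_derivative f') (at x) \<Longrightarrow> partial_deriv i f x = f' (axis i 1)"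
  unfolding partial_deriv_def by (metis frechet_derivative_at)

lemma C_diff_SucD: "C_diff (Suc n) f \<Longrightarrow> C_diff n f"
proof (induction n arbitrary: f)
  case 0
  then show ?case by (simp add: differentiable_imp_continuous_on)
next
  case (Suc n)
  then show ?case by (metis C_diff.simps(2))
qed

lemma C_diff_Suc_differentiable: "C_diff (Suc n) f \<Longrightarrow> f differentiable (at x)"
  by (simp add: differentiable_on_def)

lemma smooth_differentiable: "smooth f \<Longrightarrow> f differentiable (at x)"
  unfolding smooth_def using C_diff_Suc_differentiable by blast

lemma smooth_partial_deriv: "smooth f \<Longrightarrow> smooth (partial_deriv i f)"
  unfolding smooth_def by (metis C_diff.simps(2))

lemma smooth_continuous_on: "smooth f \<Longrightarrow> continuous_on S f"
  unfolding smooth_def by (metis C_diff.simps(1) continuous_on_subset subset_UNIV)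

lemma continuous_on_grad: "smooth f \<Longrightarrow> continuous_on S (grad f)"
  unfolding grad_def
  by (intro continuous_on_vec_lambda smooth_continuous_on smooth_partial_deriv)

lemma partial_deriv_const: "partial_deriv i (\<lambda>x. c) = (\<lambda>x. 0)"
  by (rule ext, subst partial_deriv_eqI[OF has_derivative_const]) simp

lemma C_diff_const: "C_diff n (\<lambda>x. c)"
proof (induction n arbitrary: c)
  case 0
  then show ?case by simp
next
  case (Suc n)
  then show ?case by (simp add: partial_deriv_const)
qed

lemma partial_deriv_add:
  assumes "f differentiable (at x)" "g differentiable (at x)"
  shows "partial_deriv i (\<lambda>x. f x + g x) x = partial_deriv i f x + partial_deriv i g x"
proof -
  have "((\<lambda>x. f x + g x) has_derivative
      (\<lambda>h. frechet_derivative f (at x) h + frechet_derivative g (at x) h)) (at x)"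
    using assms by (intro has_derivative_add) (simp_all add: frechet_derivative_works[symmetric])
  from partial_deriv_eqI[OF this] show ?thesis by (simp add: partial_deriv_def)
qed

lemma partial_deriv_mult:
  assumes "f differentiable (at x)" "g differentiable (at x)"
  shows "partial_deriv i (\<lambda>x. f x * g x) x = f x * partial_deriv i g x + partial_deriv i f x * g x"
proof -
  have "((\<lambda>x. f x * g x) has_derivative
      (\<lambda>h. f x * frechet_derivative g (at x) h + frechet_derivative f (at x) h * g x)) (at x)"
    using assms by (intro has_derivative_mult) (simp_all add: frechet_derivative_works[symmetric])
  from partial_deriv_eqI[OF this] show ?thesis by (simp add: partial_deriv_def)
qed

lemma C_diff_add: "C_diff n f \<Longrightarrow> C_diff n g \<Longrightarrow> C_diff n (\<lambda>x. f x + g x)"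
proof (induction n arbitrary: f g)
  case 0
  then show ?case by (simp add: continuous_on_add)
next
  case (Suc n)
  have "partial_deriv i (\<lambda>x. f x + g x) = (\<lambda>x. partial_deriv i f x + partial_deriv i g x)" for i
    using Suc.prems by (intro ext partial_deriv_add) (auto intro: C_diff_Suc_differentiable)
  then show ?case
    using Suc by (auto simp: differentiable_on_def intro: differentiable_add)
qed

lemma C_diff_mult: "C_diff n f \<Longrightarrow> C_diff n g \<Longrightarrow> C_diff n (\<lambda>x. f x * g x)"
proof (induction n arbitrary: f g)
  case 0
  then show ?case by (simp add: continuous_on_mult)
next
  case (Suc n)
  have "partial_deriv i (\<lambda>x. f x * g x) = (\<lambda>x. f x * partial_deriv i g x + partial_deriv i f x * g x)" for i
    using Suc.prems by (intro ext partial_deriv_mult) (auto intro: C_diff_Suc_differentiable)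
  moreover have "C_diff n (\<lambda>x. f x * partial_deriv i g x + partial_deriv i f x * g x)" for i
    using Suc.prems Suc.prems[THEN C_diff_SucD] by (intro C_diff_add Suc.IH) auto
  ultimately show ?case
    using Suc.prems by (auto simp: differentiable_on_def intro: differentiable_mult)
qed

lemma smooth_const: "smooth (\<lambda>x. c)"
  by (simp add: smooth_def C_diff_const)

lemma smooth_add: "smooth f \<Longrightarrow> smooth g \<Longrightarrow> smooth (\<lambda>x. f x + g x)"
  by (simp add: smooth_def C_diff_add)

lemma smooth_mult: "smooth f \<Longrightarrow> smooth g \<Longrightarrow> smooth (\<lambda>x. f x * g x)"
  by (simp add: smooth_def C_diff_mult)

lemma smooth_sum: "(\<And>i. i \<in> I \<Longrightarrow> smooth (f i)) \<Longrightarrow> smooth (\<lambda>x. \<Sum>i\<in>I. f i x)"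
  by (induction I rule: infinite_finite_induct) (auto intro: smooth_const smooth_add)

lemma smooth_prod: "(\<And>i. i \<in> I \<Longrightarrow> smooth (f i)) \<Longrightarrow> smooth (\<lambda>x. \<Prod>i\<in>I. f i x)"
  by (induction I rule: infinite_finite_induct) (auto intro: smooth_const smooth_mult)

lemma smooth_power: "smooth f \<Longrightarrow> smooth (\<lambda>x. f x ^ n)"
  by (induction n) (auto intro: smooth_const smooth_mult)

lemma partial_deriv_component: "partial_deriv j (\<lambda>x. x $ i) = (\<lambda>x. if i = j then 1 else 0)"
  by (rule ext, subst partial_deriv_eqI[OF bounded_linear.has_derivative[OF bounded_linear_vec_nth has_derivative_ident]])
     (simp add: axis_def)

lemma smooth_component: "smooth (\<lambda>x. x $ i)"
proof -
  have "C_diff n (\<lambda>x. x $ i)" for n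
  proof (cases n)
    case 0
    then show ?thesis by (simp add: continuous_on_component)
  next
    case (Suc m)
    have "(\<lambda>x. x $ i) differentiable_on UNIV"
      by (simp add: differentiable_on_def bounded_linear_imp_differentiable bounded_linear_vec_nth)
    then show ?thesis using Suc by (auto simp: partial_deriv_component C_diff_const)
  qed
  then show ?thesis by (simp add: smooth_def)
qed

lemma smooth_homogeneous_polynomial:
  assumes "homogeneous_polynomial k P"
  shows "smooth P"
proof -
  obtain c :: "('a \<Rightarrow> nat) \<Rightarrow> real" where
    "\<And>x. P x = (\<Sum>\<alpha> | (\<Sum>i\<in>UNIV. \<alpha> i) = k. c \<alpha> * (\<Prod>i\<in>UNIV. (x $ i) ^ \<alpha> i))"
    using assms unfolding homogeneous_polynomial_def by blast
  then have "P = (\<lambda>x. \<Sum>\<alpha> | (\<Sum>i\<in>UNIV. \<alpha> i) = k. c \<alpha> * (\<Prod>i\<in>UNIV. (x $ i) ^ \<alpha> i))"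
    by blast
  then show ?thesis
    by (auto intro!: smooth_sum smooth_mult smooth_const smooth_prod smooth_power smooth_component)
qed

lemma has_real_derivative_along_line:
  fixes f :: "real^'d \<Rightarrow> real"
  assumes "f differentiable (at (x + t *\<^sub>R axis i 1))"
  shows "((\<lambda>s. f (x + s *\<^sub>R axis i 1)) has_real_derivative partial_deriv i f (x + t *\<^sub>R axis i 1)) (at t)"
proof -
  let ?D = "frechet_derivative f (at (x + t *\<^sub>R axis i 1))"
  have D: "(f has_derivative ?D) (at (x + t *\<^sub>R axis i 1))"
    using assms frechet_derivative_works by blast
  have "((\<lambda>s. x + s *\<^sub>R axis i 1) has_derivative (\<lambda>s. s *\<^sub>R axis i 1)) (at t)"
    by (auto intro!: derivative_eq_intros)
  from has_derivative_compose[OF this, of f ?D] D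
  have "((\<lambda>s. f (x + s *\<^sub>R axis i 1)) has_derivative (\<lambda>s. ?D (s *\<^sub>R axis i 1))) (at t)"
    by simp
  moreover have "?D (s *\<^sub>R axis i 1) = partial_deriv i f (x + t *\<^sub>R axis i 1) * s" for s
    using linear_scale[OF has_derivative_linear[OF D]] by (simp add: partial_deriv_def)
  ultimately show ?thesis
    unfolding has_field_derivative_def by (simp add: fun_eq_iff)
qed

lemma mean_value_along_line:
  fixes f :: "real^'d \<Rightarrow> real"
  assumes "\<And>y. f differentiable (at y)" "0 < h"
  obtains t where "0 < t" "t < h"
    "f (x + h *\<^sub>R axis i 1) - f x = h * partial_deriv i f (x + t *\<^sub>R axis i 1)"
  using MVT2[of 0 h "\<lambda>s. f (x + s *\<^sub>R axis i 1)" "\<lambda>t. partial_deriv i f (x + t *\<^sub>R axis i 1)"]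
    has_real_derivative_along_line[OF assms(1)] assms(2)
  by (auto simp: algebra_simps)

text \<open>The mean value theorem is used twice: in direction \<open>i\<close> for the increment
of \<open>f\<close> over \<open>h\<close> in direction \<open>j\<close>, and then in direction \<open>j\<close> for \<open>\<partial>\<^sub>i f\<close>.\<close>

lemma second_difference_mean_value:
  fixes f :: "real^'d \<Rightarrow> real"
  assumes f: "smooth f" and h: "0 < h"
  obtains y where "dist y x \<le> 2 * h"
    "f (x + h *\<^sub>R axis i 1 + h *\<^sub>R axis j 1) - f (x + h *\<^sub>R axis i 1) - f (x + h *\<^sub>R axis j 1) + f x
       = h\<^sup>2 * partial_deriv j (partial_deriv i f) y"
proof -
  let ?g = "\<lambda>y. f (h *\<^sub>R axis j 1 + y) + (-1) * f y"
  have D: "(?g has_derivative (\<lambda>v. frechet_derivative f (at (h *\<^sub>R axis j 1 + y)) v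
        + (-1) * frechet_derivative f (at y) v)) (at y)" for y
  proof -
    have f': "(f has_derivative frechet_derivative f (at z)) (at z)" for z
      using smooth_differentiable[OF f] frechet_derivative_works by blast
    have "((\<lambda>y. h *\<^sub>R axis j 1 + y) has_derivative (\<lambda>v. v)) (at y)"
      by (auto intro!: derivative_eq_intros)
    from has_derivative_compose[OF this, of f] f'
    have "((\<lambda>y. f (h *\<^sub>R axis j 1 + y)) has_derivative frechet_derivative f (at (h *\<^sub>R axis j 1 + y))) (at y)"
      by simp
    then show ?thesis
      by (rule has_derivative_add[OF _ has_derivative_mult_right[OF f']])
  qed
  then have dg: "?g differentiable (at y)" for y
    unfolding differentiable_def by blast
  have pg: "partial_deriv i ?g y = partial_deriv i f (h *\<^sub>R axis j 1 + y) - partial_deriv i f y" for y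
    using partial_deriv_eqI[OF D] by (simp add: partial_deriv_def)
  obtain s where s: "0 < s" "s < h" "?g (x + h *\<^sub>R axis i 1) - ?g x = h * partial_deriv i ?g (x + s *\<^sub>R axis i 1)"
    using mean_value_along_line[of ?g h x i] dg h by blast
  obtain t where t: "0 < t" "t < h" "partial_deriv i f (x + s *\<^sub>R axis i 1 + h *\<^sub>R axis j 1) - partial_deriv i f (x + s *\<^sub>R axis i 1)
      = h * partial_deriv j (partial_deriv i f) (x + s *\<^sub>R axis i 1 + t *\<^sub>R axis j 1)"
    using mean_value_along_line[of "partial_deriv i f" h "x + s *\<^sub>R axis i 1" j]
      smooth_differentiable[OF smooth_partial_deriv[OF f]] h by blast
  show thesis
  proof
    have "norm (s *\<^sub>R axis i 1 + t *\<^sub>R axis j (1::real)) \<le> norm (s *\<^sub>R axis i (1::real)) + norm (t *\<^sub>R axis j (1::real))"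
      by (rule norm_triangle_ineq)
    also have "\<dots> \<le> 2 * h" using s t by simp
    finally show "dist (x + s *\<^sub>R axis i 1 + t *\<^sub>R axis j 1) x \<le> 2 * h"
      by (simp add: dist_norm algebra_simps)
    show "f (x + h *\<^sub>R axis i 1 + h *\<^sub>R axis j 1) - f (x + h *\<^sub>R axis i 1) - f (x + h *\<^sub>R axis j 1) + f x
       = h\<^sup>2 * partial_deriv j (partial_deriv i f) (x + s *\<^sub>R axis i 1 + t *\<^sub>R axis j 1)"
      using s(3) t(3) unfolding pg by (simp add: power2_eq_square algebra_simps)
  qed
qed

text \<open>The second difference quotient is symmetric in \<open>i\<close> and \<open>j\<close>, so by the mean value form
above the two mixed derivatives agree when each is taken at a suitable point arbitrarily close to \<open>x\<close>;
continuity gives equality at \<open>x\<close>.\<close>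

lemma partial_deriv_commute:
  assumes f: "smooth f"
  shows "partial_deriv i (partial_deriv j f) x = partial_deriv j (partial_deriv i f) x"
proof -
  have tendsto: "(\<lambda>n. partial_deriv q (partial_deriv p f) (y n)) \<longlonglongrightarrow> partial_deriv q (partial_deriv p f) x"
    if y: "\<And>n. dist (y n) x \<le> 2 * inverse (real (Suc n))" for y p q
  proof -
    have "(\<lambda>n. 2 * inverse (real (Suc n))) \<longlonglongrightarrow> 2 * 0"
      by (intro tendsto_mult tendsto_const LIMSEQ_inverse_real_of_nat)
    then have "y \<longlonglongrightarrow> x"
      unfolding tendsto_dist_iff[of y]
      using tendsto_sandwich[of "\<lambda>n. 0" "\<lambda>n. dist (y n) x" sequentially "\<lambda>n. 2 * inverse (real (Suc n))" 0] y
      by simp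
    moreover have "isCont (partial_deriv q (partial_deriv p f)) x"
      using smooth_continuous_on[OF smooth_partial_deriv[OF smooth_partial_deriv[OF f]], where S=UNIV]
      by (simp add: continuous_on_eq_continuous_at)
    ultimately show ?thesis by (rule isCont_tendsto_compose[rotated])
  qed
  have ex: "\<exists>y. dist y x \<le> 2 * h \<and>
      f (x + h *\<^sub>R axis p 1 + h *\<^sub>R axis q 1) - f (x + h *\<^sub>R axis p 1) - f (x + h *\<^sub>R axis q 1) + f x
       = h\<^sup>2 * partial_deriv q (partial_deriv p f) y" if "0 < h" for h p q
    by (rule second_difference_mean_value[OF f that, where x=x and i=p and j=q]) blast
  have "\<exists>y z. dist y x \<le> 2 * inverse (real (Suc n)) \<and> dist z x \<le> 2 * inverse (real (Suc n)) \<and>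
      partial_deriv i (partial_deriv j f) y = partial_deriv j (partial_deriv i f) z" for n
  proof -
    define h where "h = inverse (real (Suc n))"
    have h: "0 < h" by (simp add: h_def)
    obtain y where y: "dist y x \<le> 2 * h"
      "f (x + h *\<^sub>R axis j 1 + h *\<^sub>R axis i 1) - f (x + h *\<^sub>R axis j 1) - f (x + h *\<^sub>R axis i 1) + f x
       = h\<^sup>2 * partial_deriv i (partial_deriv j f) y"
      using ex[OF h] by blast
    obtain z where z: "dist z x \<le> 2 * h"
      "f (x + h *\<^sub>R axis i 1 + h *\<^sub>R axis j 1) - f (x + h *\<^sub>R axis i 1) - f (x + h *\<^sub>R axis j 1) + f x
       = h\<^sup>2 * partial_deriv j (partial_deriv i f) z"
      using ex[OF h] by blast
    have comm: "x + h *\<^sub>R axis j 1 + h *\<^sub>R axis i 1 = x + h *\<^sub>R axis i 1 + h *\<^sub>R axis j 1"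
      by (simp add: add_ac)
    have "h\<^sup>2 * partial_deriv i (partial_deriv j f) y = h\<^sup>2 * partial_deriv j (partial_deriv i f) z"
      using y(2) z(2) unfolding comm by linarith
    then have "partial_deriv i (partial_deriv j f) y = partial_deriv j (partial_deriv i f) z"
      using h by simp
    then show ?thesis using y(1) z(1) unfolding h_def by blast
  qed
  then obtain y z where yz: "\<And>n. dist (y n) x \<le> 2 * inverse (real (Suc n))"
      "\<And>n. dist (z n) x \<le> 2 * inverse (real (Suc n))"
      "\<And>n. partial_deriv i (partial_deriv j f) (y n) = partial_deriv j (partial_deriv i f) (z n)"
    by metis
  show ?thesis
    using tendsto[OF yz(1), of i j] tendsto[OF yz(2), of j i] LIMSEQ_unique
    unfolding yz(3) by blast
qed

section \<open>Locally integrable and locally square integrable functions\<close>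

lemma L1_loc_iff: "f \<in> L1_loc \<longleftrightarrow> (\<forall>K. compact K \<longrightarrow> f absolutely_integrable_on K)"
  by (simp add: L1_loc_def)

lemma L1_loc_add: "f \<in> L1_loc \<Longrightarrow> g \<in> L1_loc \<Longrightarrow> (\<lambda>x. f x + g x) \<in> L1_loc"
  by (simp add: L1_loc_iff set_integral_add)

lemma L1_loc_sum:
  assumes "\<And>i. i \<in> I \<Longrightarrow> f i \<in> L1_loc"
  shows "(\<lambda>x. \<Sum>i\<in>I. f i x) \<in> L1_loc"
proof -
  have "(\<lambda>x. 0) \<in> L1_loc" by (simp add: L1_loc_iff set_integrable_def)
  then show ?thesis
    using assms by (induction I rule: infinite_finite_induct) (simp_all, rule L1_loc_add, simp_all)
qed

lemma L1_loc_bounded_linear: "bounded_linear h \<Longrightarrow> f \<in> L1_loc \<Longrightarrow> (\<lambda>x. h (f x)) \<in> L1_loc"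
  unfolding L1_loc_iff o_def[symmetric, of h f] by (auto intro: absolutely_integrable_linear)

text \<open>A continuous factor is bounded on each compact set, so it preserves local integrability. Scalar
multiples and inner products are the instances used below.\<close>

lemma L1_loc_bilinear:
  fixes h :: "'a::euclidean_space \<Rightarrow> 'b::euclidean_space \<Rightarrow> 'c::euclidean_space"
  assumes h: "bounded_bilinear h" and c: "continuous_on UNIV c" and f: "f \<in> L1_loc"
  shows "(\<lambda>x::real^'d. h (c x) (f x)) \<in> L1_loc"
  unfolding L1_loc_iff
proof (intro allI impI)
  fix K :: "(real^'d) set" assume K: "compact K"
  show "(\<lambda>x. h (c x) (f x)) absolutely_integrable_on K"
  proof (rule absolutely_integrable_bounded_measurable_product[of h c K f])
    show "bilinear h"
      using h by (simp add: bilinear_conv_bounded_bilinear)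
    have cK: "continuous_on K c" using c continuous_on_subset by blast
    show "K \<in> sets lebesgue" using K by (simp add: compact_imp_closed)
    then show "c \<in> borel_measurable (lebesgue_on K)"
      by (rule continuous_imp_measurable_on_sets_lebesgue[OF cK])
    show "bounded (c ` K)"
      by (intro compact_imp_bounded compact_continuous_image cK K)
    show "f absolutely_integrable_on K" using f K by (simp add: L1_loc_iff)
  qed
qed

lemmas L1_loc_mult = L1_loc_bilinear[OF bounded_bilinear_mult]
lemmas L1_loc_scaleR = L1_loc_bilinear[OF bounded_bilinear_scaleR]
lemmas L1_loc_scaleR_flip = L1_loc_bilinear[OF bounded_bilinear.flip[OF bounded_bilinear_scaleR]]
lemmas L1_loc_inner_flip = L1_loc_bilinear[OF bounded_bilinear.flip[OF bounded_bilinear_inner]]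

lemma L1_loc_continuous:
  fixes f :: "real^'d \<Rightarrow> 'b::euclidean_space"
  assumes "continuous_on UNIV f"
  shows "f \<in> L1_loc"
  unfolding L1_loc_iff
proof (intro allI impI)
  fix K :: "(real^'d) set" assume K: "compact K"
  then obtain b where b: "K \<subseteq> cbox (-b) b"
    using bounded_subset_cbox_symmetric compact_imp_bounded by blast
  have "f absolutely_integrable_on cbox (-b) b"
    using assms by (intro absolutely_integrable_continuous) (rule continuous_on_subset, auto)
  then show "f absolutely_integrable_on K"
    by (rule set_integrable_subset[OF _ _ b]) (simp add: K compact_imp_closed)
qed

lemma L1_loc_integrable:
  assumes f: "f \<in> L1_loc" and K: "compact K" and off: "\<And>x. x \<notin> K \<Longrightarrow> f x = 0"
  shows "integrable lebesgue f"
proof -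
  have "integrable lebesgue (\<lambda>x. indicator K x *\<^sub>R f x)"
    using f K by (simp add: L1_loc_def set_integrable_def)
  moreover have "(\<lambda>x. indicator K x *\<^sub>R f x) = f"
    using off by (auto simp: indicator_def fun_eq_iff)
  ultimately show ?thesis by simp
qed

text \<open>Exhaustion by balls: membership in \<open>L1_loc\<close> only speaks about restrictions to compact
sets, and the function is the pointwise limit of these restrictions.\<close>

lemma L1_loc_measurable:
  assumes "f \<in> L1_loc"
  shows "f \<in> borel_measurable lebesgue"
proof (rule borel_measurable_LIMSEQ_metric)
  show "(\<lambda>x. indicator (cball 0 (real n)) x *\<^sub>R f x) \<in> borel_measurable lebesgue" for n
    using assms unfolding L1_loc_def set_integrable_def by (auto intro: borel_measurable_integrable)
  show "(\<lambda>n. indicator (cball 0 (real n)) x *\<^sub>R f x) \<longlonglongrightarrow> f x" for x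
  proof (rule tendsto_eventually)
    have "\<forall>\<^sub>F n in sequentially. norm x \<le> real n"
      by (rule eventually_sequentiallyI[of "nat \<lceil>norm x\<rceil>"]) linarith
    then show "\<forall>\<^sub>F n in sequentially. indicator (cball 0 (real n)) x *\<^sub>R f x = f x"
      by eventually_elim (simp add: indicator_def)
  qed
qed

lemma set_integrable_AE_bound:
  fixes f :: "'a \<Rightarrow> 'b::{banach, second_countable_topology}" and g :: "'a \<Rightarrow> 'c::{banach, second_countable_topology}"
  assumes g: "set_integrable M A g" and f: "f \<in> borel_measurable M" and A: "A \<in> sets M"
    and bound: "AE x in M. norm (f x) \<le> norm (g x)"
  shows "set_integrable M A f"
  unfolding set_integrable_def
proof (rule Bochner_Integration.integrable_bound)
  show "integrable M (\<lambda>x. indicat_real A x *\<^sub>R g x)" using g by (simp add: set_integrable_def)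
  show "(\<lambda>x. indicat_real A x *\<^sub>R f x) \<in> borel_measurable M" using f A by measurable
  show "AE x in M. norm (indicat_real A x *\<^sub>R f x) \<le> norm (indicat_real A x *\<^sub>R g x)"
    using bound by eventually_elim (simp add: indicator_def)
qed

lemma L1_loc_AE_bound:
  assumes g: "g \<in> L1_loc" and f: "f \<in> borel_measurable lebesgue"
    and bound: "AE x in lebesgue. norm (f x) \<le> norm (g x)"
  shows "f \<in> L1_loc"
  unfolding L1_loc_iff
proof (intro allI impI)
  fix K :: "(real^'a) set" assume K: "compact K"
  then have "K \<in> sets lebesgue" by (simp add: compact_imp_closed)
  moreover have "g absolutely_integrable_on K" using g K by (simp add: L1_loc_iff)
  ultimately show "f absolutely_integrable_on K"
    using set_integrable_AE_bound f bound by blast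
qed

text \<open>Membership in \<open>L2_loc\<close> is thus reduced to the closure properties of \<open>L1_loc\<close>, applied to
the squared norm.\<close>

lemma L2_loc_iff: "f \<in> L2_loc \<longleftrightarrow> f \<in> borel_measurable lebesgue \<and> (\<lambda>x. (norm (f x))\<^sup>2) \<in> L1_loc"
  by (simp add: L2_loc_def L1_loc_def)

lemma L2_loc_L1_loc:
  fixes f :: "real^'d \<Rightarrow> 'b::euclidean_space"
  assumes "f \<in> L2_loc"
  shows "f \<in> L1_loc"
proof (rule L1_loc_AE_bound)
  show "(\<lambda>x. 1 + (norm (f x))\<^sup>2) \<in> L1_loc"
    by (rule L1_loc_add[OF L1_loc_continuous]) (use assms in \<open>auto simp: L2_loc_iff\<close>)
  show "f \<in> borel_measurable lebesgue" using assms by (simp add: L2_loc_iff)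
  \<comment> \<open>from \<open>(t - 1)\<^sup>2 \<ge> 0\<close> with \<open>t = norm (f x)\<close>\<close>
  have "norm (f x) \<le> 1 + (norm (f x))\<^sup>2" for x
    using zero_le_power2[of "norm (f x) - 1"] norm_ge_zero[of "f x"]
    unfolding power2_diff one_power2 mult_1_right by linarith
  then show "AE x in lebesgue. norm (f x) \<le> norm (1 + (norm (f x))\<^sup>2)"
    unfolding real_norm_def by (intro AE_I2 order_trans[OF _ abs_ge_self])
qed

lemma L2_loc_add:
  fixes f :: "real^'d \<Rightarrow> 'b::euclidean_space"
  assumes "f \<in> L2_loc" "g \<in> L2_loc"
  shows "(\<lambda>x. f x + g x) \<in> L2_loc"
proof -
  have m: "(\<lambda>x. f x + g x) \<in> borel_measurable lebesgue"
    using assms unfolding L2_loc_iff by (intro borel_measurable_add) simp_all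
  have "(\<lambda>x. (norm (f x + g x))\<^sup>2) \<in> L1_loc"
  proof (rule L1_loc_AE_bound)
    show "(\<lambda>x. 2 * ((norm (f x))\<^sup>2 + (norm (g x))\<^sup>2)) \<in> L1_loc"
      using assms unfolding L2_loc_iff by (intro L1_loc_mult L1_loc_add) simp_all
    show "(\<lambda>x. (norm (f x + g x))\<^sup>2) \<in> borel_measurable lebesgue"
      by (intro borel_measurable_power measurable_compose[OF m borel_measurable_norm])
    have "(norm (f x + g x))\<^sup>2 \<le> 2 * ((norm (f x))\<^sup>2 + (norm (g x))\<^sup>2)" for x
    proof -
      have "(norm (f x + g x))\<^sup>2 \<le> (norm (f x) + norm (g x))\<^sup>2"
        by (intro power_mono norm_triangle_ineq norm_ge_zero)
      also have "\<dots> \<le> 2 * ((norm (f x))\<^sup>2 + (norm (g x))\<^sup>2)"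
        using zero_le_power2[of "norm (f x) - norm (g x)"] unfolding power2_diff power2_sum by simp
      finally show ?thesis .
    qed
    then show "AE x in lebesgue. norm ((norm (f x + g x))\<^sup>2) \<le> norm (2 * ((norm (f x))\<^sup>2 + (norm (g x))\<^sup>2))"
      unfolding real_norm_def abs_power2 by (intro AE_I2 order_trans[OF _ abs_ge_self])
  qed
  with m show ?thesis by (simp add: L2_loc_iff)
qed

lemma L2_loc_continuous:
  fixes f :: "real^'d \<Rightarrow> 'b::euclidean_space"
  assumes "continuous_on UNIV f"
  shows "f \<in> L2_loc"
  unfolding L2_loc_iff
proof
  show "f \<in> borel_measurable lebesgue"
    by (intro L1_loc_measurable L1_loc_continuous assms)
  show "(\<lambda>x. (norm (f x))\<^sup>2) \<in> L1_loc"
    by (intro L1_loc_continuous continuous_on_power continuous_on_norm assms)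
qed

lemma L2_loc_scaleR:
  fixes f :: "real^'d \<Rightarrow> 'b::euclidean_space"
  assumes c: "continuous_on UNIV c" and f: "f \<in> L2_loc"
  shows "(\<lambda>x. c x *\<^sub>R f x) \<in> L2_loc"
proof -
  have "(\<lambda>x. c x *\<^sub>R f x) \<in> L1_loc"
    by (intro L1_loc_scaleR c L2_loc_L1_loc f)
  moreover have "(\<lambda>x. (c x)\<^sup>2 * (norm (f x))\<^sup>2) \<in> L1_loc"
    using f by (intro L1_loc_mult continuous_on_power c) (simp add: L2_loc_iff)
  ultimately show ?thesis
    by (simp add: L2_loc_iff power_mult_distrib L1_loc_measurable)
qed

lemma L2_loc_scaleR_flip:
  fixes v :: "real^'d \<Rightarrow> 'b::euclidean_space"
  assumes v: "continuous_on UNIV v" and f: "f \<in> L2_loc"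
  shows "(\<lambda>x. f x *\<^sub>R v x) \<in> L2_loc"
proof -
  have "(\<lambda>x. f x *\<^sub>R v x) \<in> L1_loc"
    by (intro L1_loc_scaleR_flip v L2_loc_L1_loc f)
  moreover have "(\<lambda>x. (norm (v x))\<^sup>2 * (norm (f x))\<^sup>2) \<in> L1_loc"
    using f by (intro L1_loc_mult continuous_on_power continuous_on_norm v) (simp add: L2_loc_iff)
  ultimately show ?thesis
    by (simp add: L2_loc_iff power_mult_distrib mult.commute L1_loc_measurable)
qed

lemma L2_loc_sum:
  fixes f :: "'i \<Rightarrow> real^'d \<Rightarrow> 'b::euclidean_space"
  assumes "\<And>i. i \<in> I \<Longrightarrow> f i \<in> L2_loc"
  shows "(\<lambda>x. \<Sum>i\<in>I. f i x) \<in> L2_loc"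
  using assms
  by (induction I rule: infinite_finite_induct) (simp_all add: L2_loc_add L2_loc_continuous)

lemma L2_loc_AE_cong:
  fixes f :: "real^'d \<Rightarrow> 'b::euclidean_space"
  assumes f: "f \<in> L2_loc" and ae: "AE x in lebesgue. f x = g x"
  shows "g \<in> L2_loc"
proof -
  have m: "g \<in> borel_measurable lebesgue"
    using f ae borel_measurable_AE unfolding L2_loc_iff by blast
  have "(\<lambda>x. (norm (g x))\<^sup>2) \<in> L1_loc"
  proof (rule L1_loc_AE_bound)
    show "(\<lambda>x. (norm (f x))\<^sup>2) \<in> L1_loc" using f by (simp add: L2_loc_iff)
    show "(\<lambda>x. (norm (g x))\<^sup>2) \<in> borel_measurable lebesgue"
      by (intro borel_measurable_power measurable_compose[OF m borel_measurable_norm])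
    show "AE x in lebesgue. norm ((norm (g x))\<^sup>2) \<le> norm ((norm (f x))\<^sup>2)"
      using ae by eventually_elim simp
  qed
  with m show ?thesis by (simp add: L2_loc_iff)
qed

text \<open>The upper bound in \<open>elliptic_field\<close>, together with measurability, makes fluxes \<open>a v\<close> as
integrable as \<open>v\<close> itself.\<close>

lemma L1_loc_elliptic_field:
  fixes a :: "real^'d \<Rightarrow> real^'d^'d"
  assumes a: "elliptic_field lam a" and v: "v \<in> L1_loc"
  shows "(\<lambda>x. a x *v v x) \<in> L1_loc"
proof (rule L1_loc_AE_bound[OF v])
  have "a \<in> borel_measurable lebesgue" using a by (simp add: elliptic_field_def)
  moreover have "v \<in> borel_measurable lebesgue" using v by (rule L1_loc_measurable)
  moreover have "continuous_on UNIV (\<lambda>p::(real^'d^'d) \<times> (real^'d). fst p *v snd p)"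
    unfolding matrix_vector_mult_def by (intro continuous_intros)
  ultimately show "(\<lambda>x. a x *v v x) \<in> borel_measurable lebesgue"
    by (rule borel_measurable_continuous_Pair)
  have "AE x in lebesgue. \<forall>\<xi>. lam * (norm \<xi>)\<^sup>2 \<le> \<xi> \<bullet> (a x *v \<xi>) \<and> norm (a x *v \<xi>) \<le> norm \<xi>"
    using a by (simp add: elliptic_field_def)
  then show "AE x in lebesgue. norm (a x *v v x) \<le> norm (v x)"
    by eventually_elim blast
qed

section \<open>Integration by parts\<close>

lemma LINT_lebesgue_translation:
  fixes g :: "real^'d \<Rightarrow> real"
  assumes "continuous_on UNIV g"
  shows "(LINT x|lebesgue. g (x + v)) = (LINT x|lebesgue. g x)"
proof -
  have g: "g \<in> borel_measurable borel" using assms by (rule borel_measurable_continuous_onI)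
  have gv: "(\<lambda>x. g (x + v)) \<in> borel_measurable borel"
    using assms by (intro borel_measurable_continuous_onI continuous_on_compose2[OF assms] continuous_intros) auto
  have "(LINT x|lebesgue. g x) = (LINT x|lborel. g x)"
    using g by (intro integral_completion) simp
  also have "\<dots> = (LINT x|distr lborel borel ((+) v). g x)"
    by (simp add: lborel_distr_plus)
  also have "\<dots> = (LINT x|lborel. g (v + x))"
    using g by (intro integral_distr) auto
  also have "\<dots> = (LINT x|lebesgue. g (x + v))"
    using gv by (subst integral_completion) (auto simp: add.commute)
  finally show ?thesis ..
qed

lemma partial_deriv_eq_0_outside:
  assumes K: "closed K" and off: "\<And>x. x \<notin> K \<Longrightarrow> g x = 0" and x: "x \<notin> K"
  shows "partial_deriv i g x = 0"
proof -
  have "((\<lambda>x. 0) has_derivative (\<lambda>h. 0)) (at x)" by simp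
  then have "(g has_derivative (\<lambda>h. 0)) (at x)"
    by (rule has_derivative_transform_within_open[of _ _ _ _ "- K"]) (use K x off in auto)
  from partial_deriv_eqI[OF this] show ?thesis by simp
qed

text \<open>Translation invariance makes every difference quotient of \<open>g\<close> integrate to zero. By the
mean value theorem the quotients are bounded by the supremum of the derivative on a fixed ball, so
dominated convergence carries this over to the derivative.\<close>

lemma LINT_partial_deriv_eq_0:
  fixes g :: "real^'d \<Rightarrow> real"
  assumes g: "smooth g" and K: "compact K" and off: "\<And>x. x \<notin> K \<Longrightarrow> g x = 0"
  shows "(LINT x|lebesgue. partial_deriv i g x) = 0"
proof -
  define h where "h n = inverse (real (Suc n))" for n
  \<comment> \<open>difference quotients along a fixed null sequence of increments\<close>
  define d where "d n x = (g (x + h n *\<^sub>R axis i 1) - g x) / h n" for n x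
  have h: "0 < h n" "h n \<le> 1" for n by (auto simp: h_def divide_simps)
  note cont = smooth_continuous_on[OF g, of UNIV]
  have int_g: "integrable lebesgue g"
    by (rule L1_loc_integrable[OF L1_loc_continuous[OF cont] K off])
  obtain R where R: "\<And>x. x \<in> K \<Longrightarrow> norm x \<le> R"
    using compact_imp_bounded[OF K] unfolding bounded_iff by blast
  have cont_h: "continuous_on UNIV (\<lambda>x. g (x + v))" for v
    by (intro continuous_on_compose2[OF cont] continuous_intros) auto
  have int_h: "integrable lebesgue (\<lambda>x. g (x + h n *\<^sub>R axis i 1))" for n
  proof (rule L1_loc_integrable[OF L1_loc_continuous[OF cont_h]])
    show "compact ((\<lambda>x. x - h n *\<^sub>R axis i 1) ` K)"
      by (intro compact_continuous_image K continuous_intros)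
    show "g (x + h n *\<^sub>R axis i 1) = 0" if "x \<notin> (\<lambda>x. x - h n *\<^sub>R axis i 1) ` K" for x
    proof (rule off)
      show "x + h n *\<^sub>R axis i 1 \<notin> K" using that by (metis add_diff_cancel_right' image_eqI)
    qed
  qed
  have int_d: "(LINT x|lebesgue. d n x) = 0" for n
  proof -
    have "(LINT x|lebesgue. g (x + h n *\<^sub>R axis i 1) - g x) = 0"
      unfolding Bochner_Integration.integral_diff[OF int_h int_g] LINT_lebesgue_translation[OF cont] by simp
    then show ?thesis unfolding d_def by simp
  qed
  obtain B where B: "\<And>x. norm (partial_deriv i g x) \<le> B"
  proof -
    have "bounded (partial_deriv i g ` K)"
      by (intro compact_imp_bounded compact_continuous_image K smooth_continuous_on smooth_partial_deriv g)
    then obtain B where "\<And>x. x \<in> K \<Longrightarrow> norm (partial_deriv i g x) \<le> B"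
      unfolding bounded_iff by blast
    then have "norm (partial_deriv i g x) \<le> max B 0" for x
      using partial_deriv_eq_0_outside[where x=x and i=i and g=g, OF compact_imp_closed[OF K] off]
      by (cases "x \<in> K") (auto intro: max.coboundedI1)
    then show thesis by (rule that)
  qed
  have mv: "\<exists>t. 0 < t \<and> t < h n \<and> d n x = partial_deriv i g (x + t *\<^sub>R axis i 1)" for n x
  proof -
    obtain t where "0 < t" "t < h n"
      "g (x + h n *\<^sub>R axis i 1) - g x = h n * partial_deriv i g (x + t *\<^sub>R axis i 1)"
      using mean_value_along_line[OF smooth_differentiable[OF g] h(1)] by blast
    then show ?thesis using h(1)[of n] by (auto simp: d_def)
  qed
  have "(\<lambda>n. LINT x|lebesgue. d n x) \<longlonglongrightarrow> (LINT x|lebesgue. partial_deriv i g x)"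
  proof (rule integral_dominated_convergence)
    show "partial_deriv i g \<in> borel_measurable lebesgue"
      by (intro L1_loc_measurable L1_loc_continuous smooth_continuous_on smooth_partial_deriv g)
    show "d n \<in> borel_measurable lebesgue" for n
      unfolding d_def using int_h[of n] int_g by (intro borel_measurable_divide borel_measurable_diff) auto
    show "integrable lebesgue (\<lambda>x. indicator (cball (0::real^'d) (R + 1)) x *\<^sub>R B)"
    proof -
      have "(\<lambda>x::real^'d. B) \<in> L1_loc" by (rule L1_loc_continuous) simp
      then have "\<forall>K::(real^'d) set. compact K \<longrightarrow> integrable lebesgue (\<lambda>x. indicator K x *\<^sub>R B)"
        by (simp only: L1_loc_def set_integrable_def mem_Collect_eq)
      from this[rule_format, OF compact_cball] show ?thesis .
    qed
    show "AE x in lebesgue. norm (d n x) \<le> indicator (cball 0 (R + 1)) x *\<^sub>R B" for n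
    proof (rule AE_I2)
      fix x
      show "norm (d n x) \<le> indicator (cball 0 (R + 1)) x *\<^sub>R B"
      proof (cases "x \<in> cball 0 (R + 1)")
        case True
        with mv[of n x] B show ?thesis by auto
      next
        case False
        have "norm x \<le> norm (x + h n *\<^sub>R axis i 1) + norm (h n *\<^sub>R axis i (1::real))"
          using norm_triangle_ineq4[of "x + h n *\<^sub>R axis i 1" "h n *\<^sub>R axis i 1"] by simp
        then have "norm x \<le> norm (x + h n *\<^sub>R axis i 1) + 1"
          using h[of n] by simp
        then have "x + h n *\<^sub>R axis i 1 \<notin> K" "x \<notin> K"
          using False R[of "x + h n *\<^sub>R axis i 1"] R[of x] by auto
        then show ?thesis using False off by (simp add: d_def)
      qed
    qed
    show "AE x in lebesgue. (\<lambda>n. d n x) \<longlonglongrightarrow> partial_deriv i g x"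
    proof (rule AE_I2)
      fix x
      have "((\<lambda>s. g (x + s *\<^sub>R axis i 1)) has_real_derivative partial_deriv i g x) (at 0)"
        using has_real_derivative_along_line[OF smooth_differentiable[OF g], where x=x and t=0 and i=i] by simp
      then have "((\<lambda>s. (g (x + s *\<^sub>R axis i 1) - g x) / s) \<longlongrightarrow> partial_deriv i g x) (at 0)"
        by (simp add: DERIV_def)
      moreover have "filterlim h (at 0) sequentially"
        unfolding filterlim_at using h(1) LIMSEQ_inverse_real_of_nat
        by (auto simp: h_def[abs_def])
      ultimately show "(\<lambda>n. d n x) \<longlonglongrightarrow> partial_deriv i g x"
        unfolding d_def by (rule filterlim_compose)
    qed
  qed
  then have "(\<lambda>n. 0) \<longlonglongrightarrow> (LINT x|lebesgue. partial_deriv i g x)"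
    unfolding int_d .
  from LIMSEQ_unique[OF this tendsto_const] show ?thesis .
qed

lemma test_functions_iff: "\<eta> \<in> test_functions \<longleftrightarrow> smooth \<eta> \<and> compact (closure {x. \<eta> x \<noteq> 0})"
  by (simp add: test_functions_def smooth_def)

lemma test_functionsI:
  assumes "smooth \<eta>" "compact K" "\<And>x. x \<notin> K \<Longrightarrow> \<eta> x = 0"
  shows "\<eta> \<in> test_functions"
proof -
  have "closure {x. \<eta> x \<noteq> 0} \<subseteq> K"
    using assms by (intro closure_minimal compact_imp_closed) auto
  then have "compact (closure {x. \<eta> x \<noteq> 0})"
    using assms(2) by (metis closed_closure compact_Int_closed inf.absorb_iff2)
  with assms(1) show ?thesis by (simp add: test_functions_iff)
qed

text \<open>All data of a test function vanish off one compact set, which is how integrability against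
locally integrable functions is obtained.\<close>

lemma test_functionsE:
  assumes "\<eta> \<in> test_functions"
  obtains K where "smooth \<eta>" "compact K" "\<And>x. x \<notin> K \<Longrightarrow> \<eta> x = 0"
    "\<And>i x. x \<notin> K \<Longrightarrow> partial_deriv i \<eta> x = 0" "\<And>x. x \<notin> K \<Longrightarrow> grad \<eta> x = 0"
proof
  let ?K = "closure {x. \<eta> x \<noteq> 0}"
  show "smooth \<eta>" "compact ?K" using assms by (auto simp: test_functions_iff)
  show off: "\<eta> x = 0" if "x \<notin> ?K" for x
    using that closure_subset[of "{x. \<eta> x \<noteq> 0}"] by blast
  show off': "partial_deriv i \<eta> x = 0" if "x \<notin> ?K" for x i
    by (rule partial_deriv_eq_0_outside[OF closed_closure off that])
  show "grad \<eta> x = 0" if "x \<notin> ?K" for x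
    using off'[OF that] by (simp add: grad_def vec_eq_iff)
qed

lemma test_functions_partial_deriv:
  assumes "\<eta> \<in> test_functions"
  shows "partial_deriv i \<eta> \<in> test_functions"
  using assms by (elim test_functionsE) (rule test_functionsI[OF smooth_partial_deriv])

lemma test_functions_mult:
  assumes "smooth f" "\<eta> \<in> test_functions"
  shows "(\<lambda>x. f x * \<eta> x) \<in> test_functions"
  using assms(2)
proof (rule test_functionsE)
  fix K assume "smooth \<eta>" "compact K" and off: "\<And>x. x \<notin> K \<Longrightarrow> \<eta> x = 0"
  then show ?thesis
    using assms(1) by (intro test_functionsI[of _ K] smooth_mult) simp_all
qed

lemma L1_loc_times_test_integrable:
  assumes "u \<in> L1_loc" "\<eta> \<in> test_functions"
  shows "integrable lebesgue (\<lambda>x. u x * \<eta> x)"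
proof -
  obtain K where K: "smooth \<eta>" "compact K" "\<And>x. x \<notin> K \<Longrightarrow> \<eta> x = 0"
    by (rule test_functionsE[OF assms(2)], rule that)
  have "(\<lambda>x. \<eta> x * u x) \<in> L1_loc"
    using L1_loc_mult[OF smooth_continuous_on[OF K(1)] assms(1)] .
  then show ?thesis
    using K(2,3) by (intro L1_loc_integrable[of _ K]) (simp_all add: mult.commute)
qed

text \<open>The integral of \<open>\<partial>\<^sub>i (f \<eta>)\<close> vanishes, as \<open>f \<eta>\<close> has compact support.\<close>

lemma has_weak_grad_smooth:
  fixes f :: "real^'d \<Rightarrow> real"
  assumes f: "smooth f"
  shows "has_weak_grad f (grad f)"
  unfolding has_weak_grad_def
proof (intro conjI ballI allI)
  show f1: "f \<in> L1_loc" by (intro L1_loc_continuous smooth_continuous_on f)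
  show "grad f \<in> L1_loc" by (intro L1_loc_continuous continuous_on_grad f)
  fix \<eta> :: "real^'d \<Rightarrow> real" and i assume \<eta>: "\<eta> \<in> test_functions"
  have pf1: "partial_deriv i f \<in> L1_loc"
    by (intro L1_loc_continuous smooth_continuous_on smooth_partial_deriv f)
  note ints = L1_loc_times_test_integrable[OF f1 test_functions_partial_deriv[OF \<eta>]]
    L1_loc_times_test_integrable[OF pf1 \<eta>]
  have "(LINT x|lebesgue. partial_deriv i (\<lambda>x. f x * \<eta> x) x) = 0"
    using test_functions_mult[OF f \<eta>]
    by (elim test_functionsE) (rule LINT_partial_deriv_eq_0)
  moreover have "smooth \<eta>" using \<eta> by (simp add: test_functions_iff)
  ultimately have "(LINT x|lebesgue. f x * partial_deriv i \<eta> x + partial_deriv i f x * \<eta> x) = 0"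
    by (simp add: partial_deriv_mult smooth_differentiable f)
  then show "(LINT x|lebesgue. f x * partial_deriv i \<eta> x) = - (LINT x|lebesgue. grad f x $ i * \<eta> x)"
    using ints by (simp add: Bochner_Integration.integral_add grad_def)
qed

section \<open>The fundamental lemma of the calculus of variations\<close>

text \<open>The classical smooth function that is flat at the origin. The factor \<open>t ^ n\<close> in the
denominator makes the family closed under differentiation up to linear combinations, so that smoothness
follows by an induction over all members at once.\<close>

definition flat :: "nat \<Rightarrow> real \<Rightarrow> real \<Rightarrow> real" where
  "flat n c t = (if 0 < t then exp (- c / t) / t ^ n else 0)"

text \<open>With \<open>y = c / t\<close> this is the decay of \<open>y ^ n / exp y\<close> as \<open>y\<close> tends to infinity.\<close>

lemma flat_tendsto_0:
  assumes c: "0 < c"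
  shows "(flat n c \<longlongrightarrow> 0) (at 0)"
proof -
  have "filterlim (\<lambda>t. c * inverse t) at_top (at_right (0::real))"
    using c by (intro filterlim_tendsto_pos_mult_at_top[OF tendsto_const]) (auto simp: filterlim_inverse_at_top_right)
  then have "((\<lambda>t. (c * inverse t) ^ n / exp (c * inverse t)) \<longlongrightarrow> 0) (at_right 0)"
    by (rule filterlim_compose[OF tendsto_power_div_exp_0])
  then have "((\<lambda>t. inverse (c ^ n) * ((c * inverse t) ^ n / exp (c * inverse t))) \<longlongrightarrow> 0) (at_right 0)"
    by (rule tendsto_mult_right_zero)
  moreover have "\<forall>\<^sub>F t in at_right 0. inverse (c ^ n) * ((c * inverse t) ^ n / exp (c * inverse t)) = flat n c t"
    using eventually_at_right_less[of 0]
    by eventually_elim (use c in \<open>simp add: flat_def exp_minus field_simps\<close>)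
  ultimately have "(flat n c \<longlongrightarrow> 0) (at_right 0)"
    by (rule Lim_transform_eventually)
  moreover have "(flat n c \<longlongrightarrow> 0) (at_left 0)"
  proof (rule tendsto_eventually)
    show "\<forall>\<^sub>F t in at_left 0. flat n c t = 0"
      by (auto simp: flat_def eventually_at_filter)
  qed
  ultimately show ?thesis by (simp add: filterlim_split_at)
qed

text \<open>Only \<open>t = 0\<close> needs an argument: there the difference quotient of \<open>flat n c\<close> is
\<open>flat (n + 1) c\<close>, which tends to \<open>0\<close>.\<close>

lemma has_real_derivative_flat:
  assumes c: "0 < c"
  shows "(flat n c has_real_derivative c * flat (n + 2) c t - real n * flat (n + 1) c t) (at t)"
proof (cases t "0::real" rule: linorder_cases)
  case less
  have "((\<lambda>_. 0) has_real_derivative 0) (at t)" by simp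
  then have "(flat n c has_real_derivative 0) (at t)"
    by (rule has_field_derivative_transform_within_open[of _ _ _ "{..<0}"]) (use less in \<open>auto simp: flat_def\<close>)
  then show ?thesis using less by (simp add: flat_def)
next
  case equal
  have "((\<lambda>h. (flat n c (0 + h) - flat n c 0) / h) \<longlongrightarrow> 0) (at 0)"
  proof (rule Lim_transform_eventually[OF flat_tendsto_0[OF c, of "Suc n"]])
    show "\<forall>\<^sub>F h in at 0. flat (Suc n) c h = (flat n c (0 + h) - flat n c 0) / h"
      by (auto simp: flat_def eventually_at_filter)
  qed
  then show ?thesis using equal by (simp add: DERIV_def flat_def)
next
  case greater
  have flat_inverse: "flat m c s = exp (- c * inverse s) * inverse s ^ m" if "0 < s" for m s
    using that by (simp add: flat_def divide_inverse power_inverse)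
  have inv: "(inverse has_real_derivative - (inverse t ^ 2)) (at t)"
    using DERIV_inverse[of t] greater by (simp add: power2_eq_square)
  have "((\<lambda>t. exp (- c * inverse t)) has_real_derivative exp (- c * inverse t) * (- c * - (inverse t ^ 2))) (at t)"
    by (rule DERIV_chain2[OF DERIV_exp DERIV_cmult[OF inv]])
  moreover have "((\<lambda>t. inverse t ^ n) has_real_derivative real n * (- (inverse t ^ 2) * inverse t ^ (n - Suc 0))) (at t)"
    by (rule DERIV_power[OF inv])
  ultimately have "((\<lambda>t. exp (- c * inverse t) * inverse t ^ n) has_real_derivative
      exp (- c * inverse t) * (- c * - (inverse t ^ 2)) * inverse t ^ n
      + real n * (- (inverse t ^ 2) * inverse t ^ (n - Suc 0)) * exp (- c * inverse t)) (at t)"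
    by (rule DERIV_mult)
  moreover have "exp (- c * inverse t) * (- c * - (inverse t ^ 2)) * inverse t ^ n
      + real n * (- (inverse t ^ 2) * inverse t ^ (n - Suc 0)) * exp (- c * inverse t)
      = c * flat (n + 2) c t - real n * flat (n + 1) c t"
    unfolding flat_inverse[OF greater] by (cases n) (simp_all add: power_add power2_eq_square algebra_simps)
  ultimately have "((\<lambda>t. exp (- c * inverse t) * inverse t ^ n) has_real_derivative
      c * flat (n + 2) c t - real n * flat (n + 1) c t) (at t)"
    by (rule DERIV_cong)
  then show ?thesis
    by (rule has_field_derivative_transform_within_open[of _ _ _ "{0<..}"])
      (use greater flat_inverse in auto)
qed

lemma has_derivative_flat_component:
  assumes c: "0 < c"
  shows "((\<lambda>x. flat n c (s * x $ i + b)) has_derivative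
    (\<lambda>h. (c * flat (n + 2) c (s * x $ i + b) - real n * flat (n + 1) c (s * x $ i + b)) * (s * h $ i))) (at x)"
proof -
  have "((\<lambda>x. s * x $ i + b) has_derivative (\<lambda>h. s * h $ i)) (at x)"
    by (auto intro!: derivative_eq_intros bounded_linear.has_derivative[OF bounded_linear_vec_nth])
  from has_derivative_compose[OF this, of "flat n c"] has_real_derivative_flat[OF c]
  show ?thesis by (auto simp: has_field_derivative_def mult_commute_abs)
qed

lemma C_diff_flat_component:
  assumes c: "0 < c"
  shows "C_diff m (\<lambda>x. flat n c (s * x $ i + b))"
proof (induction m arbitrary: n)
  case 0
  have "(\<lambda>x. flat n c (s * x $ i + b)) differentiable_on UNIV"
    using has_derivative_flat_component[OF c] unfolding differentiable_on_def differentiable_def by blast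
  then show ?case by (simp add: differentiable_imp_continuous_on)
next
  case (Suc m)
  have "(\<lambda>x. flat n c (s * x $ i + b)) differentiable_on UNIV"
    using has_derivative_flat_component[OF c] unfolding differentiable_on_def differentiable_def by blast
  moreover have "partial_deriv j (\<lambda>x. flat n c (s * x $ i + b)) = (\<lambda>x.
      (c * (s * axis j 1 $ i)) * flat (n + 2) c (s * x $ i + b)
      + (- real n * (s * axis j 1 $ i)) * flat (n + 1) c (s * x $ i + b))" for j
    by (rule ext, subst partial_deriv_eqI[OF has_derivative_flat_component[OF c]]) (simp add: algebra_simps)
  ultimately show ?case
    by (simp only: C_diff.simps) (intro conjI allI C_diff_add C_diff_mult C_diff_const Suc.IH TrueI)
qed

text \<open>Both factors have the shape \<open>flat 0 c (s * x $ i + b)\<close> with \<open>s\<close> equal to \<open>1\<close> or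
\<open>-1\<close>, the form whose smoothness is established above.\<close>

definition box_bump :: "real \<Rightarrow> real^'d \<Rightarrow> real^'d \<Rightarrow> real^'d \<Rightarrow> real" where
  "box_bump c l u x = (\<Prod>i\<in>UNIV. flat 0 c (1 * x $ i + - l $ i) * flat 0 c ((-1) * x $ i + u $ i))"

lemma box_bump_outside: "x \<notin> box l u \<Longrightarrow> box_bump c l u x = 0"
  by (auto simp: box_bump_def mem_box_cart flat_def)

lemma box_bump_test_function:
  assumes "0 < c"
  shows "box_bump c l u \<in> test_functions"
proof (rule test_functionsI)
  show "smooth (box_bump c l u)"
    unfolding box_bump_def[abs_def]
    by (intro smooth_prod smooth_mult) (simp_all only: smooth_def C_diff_flat_component[OF assms] simp_thms)
  show "compact (cbox l u)" by (rule compact_cbox)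
  show "box_bump c l u x = 0" if "x \<notin> cbox l u" for x
    using that box_subset_cbox box_bump_outside by blast
qed

lemma box_bump_bounds:
  assumes "0 < c"
  shows "0 \<le> box_bump c l u x" "box_bump c l u x \<le> 1"
proof -
  have flat: "0 \<le> flat 0 c t" "flat 0 c t \<le> 1" for t
    using assms by (auto simp: flat_def)
  show "0 \<le> box_bump c l u x" unfolding box_bump_def by (intro prod_nonneg mult_nonneg_nonneg flat ballI)
  show "box_bump c l u x \<le> 1"
    unfolding box_bump_def by (intro prod_le_1 conjI mult_nonneg_nonneg mult_le_one flat)
qed

text \<open>On the positive half line \<open>flat 0 c t = exp (- c / t)\<close> increases to \<open>1\<close> as \<open>c\<close> decreases
to \<open>0\<close>; this turns the bumps into approximations of the indicator of an open box.\<close>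

lemma box_bump_tendsto: "(\<lambda>n. box_bump (inverse (real (Suc n))) l u x) \<longlonglongrightarrow> indicator (box l u) x"
proof (cases "x \<in> box l u")
  case True
  have flat: "(\<lambda>n. flat 0 (inverse (real (Suc n))) t) \<longlonglongrightarrow> 1" if "0 < t" for t
  proof -
    have "(\<lambda>n. exp (- inverse (real (Suc n)) / t)) \<longlonglongrightarrow> exp (- 0 / t)"
      by (intro tendsto_exp tendsto_divide tendsto_minus LIMSEQ_inverse_real_of_nat tendsto_const) (use that in simp)
    then show ?thesis using that by (simp add: flat_def)
  qed
  have "(\<lambda>n. box_bump (inverse (real (Suc n))) l u x) \<longlonglongrightarrow> (\<Prod>i\<in>(UNIV::'a set). 1 * 1)"
    unfolding box_bump_def
    by (intro tendsto_prod tendsto_mult flat) (use True in \<open>auto simp: mem_box_cart\<close>)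
  then show ?thesis using True by simp
next
  case False
  then show ?thesis by (simp add: box_bump_outside)
qed

text \<open>The bumps of the box converge boundedly to its indicator, so dominated convergence with
majorant \<open>\<bar>g\<bar>\<close> on the closed box applies.\<close>

lemma set_integral_box_eq_0:
  fixes g :: "real^'d \<Rightarrow> real"
  assumes g: "g \<in> L1_loc" and zero: "\<And>\<eta>. \<eta> \<in> test_functions \<Longrightarrow> (LINT x|lebesgue. g x * \<eta> x) = 0"
  shows "(LINT x:box l u|lebesgue. g x) = 0"
proof -
  let ?b = "\<lambda>n. box_bump (inverse (real (Suc n))) l u"
  have b: "?b n \<in> test_functions" for n by (rule box_bump_test_function) simp
  have int: "set_integrable lebesgue (cbox l u) g" using g by (simp add: L1_loc_def)
  have "(\<lambda>n. LINT x|lebesgue. g x * ?b n x) \<longlonglongrightarrow> (LINT x|lebesgue. indicator (box l u) x *\<^sub>R g x)"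
  proof (rule integral_dominated_convergence)
    show "integrable lebesgue (\<lambda>x. norm (indicator (cbox l u) x *\<^sub>R g x))"
      using int unfolding set_integrable_def by (rule integrable_norm)
    show "(\<lambda>x. indicat_real (box l u) x *\<^sub>R g x) \<in> borel_measurable lebesgue"
      using set_integrable_subset[OF int _ box_subset_cbox] unfolding set_integrable_def by auto
    show "(\<lambda>x. g x * ?b n x) \<in> borel_measurable lebesgue" for n
      using L1_loc_times_test_integrable[OF g b] by (rule borel_measurable_integrable)
    show "AE x in lebesgue. (\<lambda>n. g x * ?b n x) \<longlonglongrightarrow> indicat_real (box l u) x *\<^sub>R g x"
      using tendsto_mult[OF tendsto_const box_bump_tendsto] by (intro AE_I2) (simp add: mult.commute)
    show "AE x in lebesgue. norm (g x * ?b n x) \<le> norm (indicat_real (cbox l u) x *\<^sub>R g x)" for n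
    proof (rule AE_I2)
      fix x
      show "norm (g x * ?b n x) \<le> norm (indicat_real (cbox l u) x *\<^sub>R g x)"
      proof (cases "x \<in> box l u")
        case True
        then have "x \<in> cbox l u" using box_subset_cbox by blast
        moreover have "\<bar>g x\<bar> * \<bar>?b n x\<bar> \<le> \<bar>g x\<bar> * 1"
          using box_bump_bounds[of "inverse (real (Suc n))" l u x] by (intro mult_left_mono) auto
        ultimately show ?thesis by (simp add: abs_mult)
      qed (simp add: box_bump_outside)
    qed
  qed
  then have "(\<lambda>n. 0) \<longlonglongrightarrow> (LINT x:box l u|lebesgue. g x)"
    unfolding zero[OF b] set_lebesgue_integral_def .
  from LIMSEQ_unique[OF this tendsto_const] show ?thesis .
qed

text \<open>Open boxes form an intersection-stable generator of the Borel sets, and the sets over which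
\<open>f\<close> integrates to zero form a Dynkin system.\<close>

lemma set_integral_eq_0_borel:
  fixes f :: "'a::euclidean_space \<Rightarrow> real"
  assumes f: "integrable lebesgue f" and f0: "(LINT x|lebesgue. f x) = 0"
    and box0: "\<And>l u. (LINT x:box l u|lebesgue. f x) = 0"
    and A: "A \<in> sets borel"
  shows "(LINT x:A|lebesgue. f x) = 0"
proof -
  let ?G = "range (\<lambda>(a, b). box a b :: 'a set)"
  have sigma: "sigma_sets UNIV ?G = sets borel"
    by (simp add: borel_eq_box)
  have int: "set_integrable lebesgue A f" if "A \<in> sets borel" for A
    using that f unfolding set_integrable_def by (intro integrable_mult_indicator) auto
  have "Int_stable ?G" by (auto simp: Int_stable_def box_Int_box)
  moreover have "?G \<subseteq> Pow UNIV" by auto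
  moreover have "A \<in> sigma_sets UNIV ?G" using A sigma by simp
  ultimately show ?thesis
  proof (induction rule: sigma_sets_induct_disjoint)
    case (basic A)
    then show ?case using box0 by auto
  next
    case empty
    then show ?case by (simp add: set_lebesgue_integral_def)
  next
    case (compl A)
    then have A: "A \<in> sets borel" and A': "UNIV - A \<in> sets borel" using sigma by auto
    have "(LINT x:A \<union> (UNIV - A)|lebesgue. f x) = (LINT x:A|lebesgue. f x) + (LINT x:UNIV - A|lebesgue. f x)"
      by (rule set_integral_Un[OF _ int[OF A] int[OF A']]) blast
    moreover have "(LINT x:A \<union> (UNIV - A)|lebesgue. f x) = 0"
      using f0 by (simp add: set_lebesgue_integral_def)
    ultimately show ?case using compl.IH by simp
  next
    case (union A)
    then have A: "A i \<in> sets borel" for i using sigma by auto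
    have "(LINT x:(\<Union>i. A i)|lebesgue. f x) = (\<Sum>i. (LINT x:(A i)|lebesgue. f x))"
    proof (rule lebesgue_integral_countable_add)
      show "A i \<in> sets lebesgue" for i using A by simp
      show "A i \<inter> A j = {}" if "i \<noteq> j" for i j
        using union.hyps(1) that by (auto simp: disjoint_family_on_def)
      show "set_integrable lebesgue (\<Union>i. A i) f" using A by (intro int) auto
    qed
    then show ?case using union.IH by simp
  qed
qed

text \<open>A Lebesgue set differs from a Borel set by a null set.\<close>

lemma set_integral_eq_0_lebesgue:
  fixes f :: "'a::euclidean_space \<Rightarrow> real"
  assumes f: "integrable lebesgue f" and zero: "\<And>A. A \<in> sets borel \<Longrightarrow> (LINT x:A|lebesgue. f x) = 0"
    and A: "A \<in> sets lebesgue"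
  shows "(LINT x:A|lebesgue. f x) = 0"
proof -
  obtain S N N' where S: "A = S \<union> N" "N \<subseteq> N'" "N' \<in> null_sets lborel" "S \<in> sets lborel"
    using A by (rule sets_completionE)
  have "(LINT x:A|lebesgue. f x) = (LINT x:S|lebesgue. f x)"
  proof (rule set_integral_cong_set)
    have meas: "set_borel_measurable lebesgue B f" if "B \<in> sets lebesgue" for B
      unfolding set_borel_measurable_def
      by (intro borel_measurable_scaleR borel_measurable_indicator that borel_measurable_integrable f)
    show "set_borel_measurable lebesgue S f"
      by (rule meas) (rule sets_completionI_sets[OF S(4)])
    show "set_borel_measurable lebesgue A f"
      by (rule meas[OF A])
    have "N' \<in> null_sets lebesgue" using S(3) by (rule null_sets_completionI)
    then have "AE x in lebesgue. x \<notin> N'" by (rule AE_not_in)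
    then show "AE x in lebesgue. x \<in> S \<longleftrightarrow> x \<in> A"
      by eventually_elim (use S in auto)
  qed
  also have "\<dots> = 0" using S(4) by (intro zero) simp
  finally show ?thesis .
qed

lemma sigma_finite_lebesgue: "sigma_finite_measure (lebesgue :: 'a::euclidean_space measure)"
proof
  let ?Q = "\<lambda>n::nat. box (- (real n *\<^sub>R One)) (real n *\<^sub>R One) :: 'a set"
  have "emeasure lebesgue (?Q n) \<noteq> \<infinity>" for n
    using emeasure_lborel_box_finite[of "- (real n *\<^sub>R One)" "real n *\<^sub>R One :: 'a"] by simp
  then show "\<exists>A::'a set set. countable A \<and> A \<subseteq> sets lebesgue \<and> \<Union> A = space lebesgue \<and> (\<forall>a\<in>A. emeasure lebesgue a \<noteq> \<infinity>)"
    using UN_box_eq_UNIV[where 'a='a] by (intro exI[of _ "range ?Q"]) auto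
qed

text \<open>The fundamental lemma of the calculus of variations. As \<open>g\<close> is only locally integrable, it is
cut off to an exhausting sequence of open boxes; boxes intersect in boxes, so the cut-off function still
integrates to zero over every box.\<close>

lemma AE_eq_0_if_orthogonal_to_test_functions:
  fixes g :: "real^'d \<Rightarrow> real"
  assumes g: "g \<in> L1_loc" and zero: "\<And>\<eta>. \<eta> \<in> test_functions \<Longrightarrow> (LINT x|lebesgue. g x * \<eta> x) = 0"
  shows "AE x in lebesgue. g x = 0"
proof -
  define Q :: "nat \<Rightarrow> (real^'d) set" where "Q n = box (- (real n *\<^sub>R One)) (real n *\<^sub>R One)" for n
  have "AE x in lebesgue. indicator (Q n) x *\<^sub>R g x = 0" for n
  proof (rule sigma_finite_measure.density_zero[OF sigma_finite_lebesgue])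
    have "set_integrable lebesgue (cbox (- (real n *\<^sub>R One)) (real n *\<^sub>R One)) g"
      using g by (simp add: L1_loc_def)
    then have "set_integrable lebesgue (Q n) g"
      unfolding Q_def by (rule set_integrable_subset) (simp_all add: box_subset_cbox)
    then show int: "integrable lebesgue (\<lambda>x. indicator (Q n) x *\<^sub>R g x)"
      by (simp add: set_integrable_def)
    fix A :: "(real^'d) set" assume A: "A \<in> sets lebesgue"
    show "(LINT x:A|lebesgue. indicator (Q n) x *\<^sub>R g x) = 0"
    proof (rule set_integral_eq_0_lebesgue[OF int _ A])
      show "(LINT x:A|lebesgue. indicator (Q n) x *\<^sub>R g x) = 0" if "A \<in> sets borel" for A
      proof (rule set_integral_eq_0_borel[OF int _ _ that])
        show "(LINT x|lebesgue. indicator (Q n) x *\<^sub>R g x) = 0"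
          using set_integral_box_eq_0[OF g zero] by (simp add: Q_def set_lebesgue_integral_def)
        show "(LINT x:box l u|lebesgue. indicator (Q n) x *\<^sub>R g x) = 0" for l u
        proof -
          obtain l' u' where "box l u \<inter> Q n = box l' u'"
            unfolding Q_def box_Int_box by blast
          then have "indicator (box l u) x *\<^sub>R indicator (Q n) x *\<^sub>R g x = indicator (box l' u') x *\<^sub>R g x" for x
            by (metis indicator_inter_arith scaleR_scaleR)
          then show ?thesis
            using set_integral_box_eq_0[OF g zero, of l' u'] by (simp only: set_lebesgue_integral_def)
        qed
      qed
    qed
  qed
  then have "AE x in lebesgue. \<forall>n. indicator (Q n) x *\<^sub>R g x = 0"
    unfolding AE_all_countable ..
  then show ?thesis
  proof eventually_elim
    case (elim x)
    have "x \<in> (\<Union>n. Q n)" unfolding Q_def by (simp only: UN_box_eq_UNIV UNIV_I)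
    then obtain n where "x \<in> Q n" by blast
    then show ?case using elim by (metis indicator_simps(1) scaleR_one)
  qed
qed

section \<open>Weak gradients\<close>

lemma has_weak_gradI:
  fixes u :: "real^'d \<Rightarrow> real"
  assumes "u \<in> L1_loc" "G \<in> L1_loc"
    "\<And>\<eta> i. \<eta> \<in> test_functions \<Longrightarrow>
      (LINT x|lebesgue. u x * partial_deriv i \<eta> x) = - (LINT x|lebesgue. G x $ i * \<eta> x)"
  shows "has_weak_grad u G"
  using assms by (simp add: has_weak_grad_def)

lemma has_weak_gradD:
  assumes "has_weak_grad u G"
  shows "u \<in> L1_loc" "G \<in> L1_loc"
    "\<eta> \<in> test_functions \<Longrightarrow>
      (LINT x|lebesgue. u x * partial_deriv i \<eta> x) = - (LINT x|lebesgue. G x $ i * \<eta> x)"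
  using assms by (simp_all add: has_weak_grad_def)

text \<open>The value of \<open>weak_grad\<close> is an arbitrary choice among all weak gradients; this lemma is what
allows replacing it by an explicitly computed gradient.\<close>

lemma has_weak_grad_unique:
  fixes u :: "real^'d \<Rightarrow> real"
  assumes G: "has_weak_grad u G" and H: "has_weak_grad u H"
  shows "AE x in lebesgue. G x = H x"
proof -
  have "AE x in lebesgue. G x $ i + (-1) * H x $ i = 0" for i
  proof (rule AE_eq_0_if_orthogonal_to_test_functions)
    have Gi: "(\<lambda>x. G x $ i) \<in> L1_loc" and Hi: "(\<lambda>x. (-1) * H x $ i) \<in> L1_loc"
      using has_weak_gradD(2)[OF G] has_weak_gradD(2)[OF H]
      by (intro L1_loc_mult continuous_on_const L1_loc_bounded_linear[OF bounded_linear_vec_nth]; simp)+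
    then show "(\<lambda>x. G x $ i + (-1) * H x $ i) \<in> L1_loc" by (rule L1_loc_add)
    fix \<eta> :: "real^'d \<Rightarrow> real" assume \<eta>: "\<eta> \<in> test_functions"
    have "(LINT x|lebesgue. (G x $ i + (-1) * H x $ i) * \<eta> x)
        = (LINT x|lebesgue. G x $ i * \<eta> x) + (LINT x|lebesgue. ((-1) * H x $ i) * \<eta> x)"
      unfolding distrib_right
      by (rule Bochner_Integration.integral_add; rule L1_loc_times_test_integrable[OF _ \<eta>]) (fact Gi Hi)+
    then show "(LINT x|lebesgue. (G x $ i + (-1) * H x $ i) * \<eta> x) = 0"
      using has_weak_gradD(3)[OF G \<eta>, of i] has_weak_gradD(3)[OF H \<eta>, of i] by simp
  qed
  then have "AE x in lebesgue. \<forall>i\<in>UNIV. G x $ i + (-1) * H x $ i = 0"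
    by (intro AE_finite_allI) auto
  then show ?thesis
    by eventually_elim (simp add: vec_eq_iff)
qed

lemma has_weak_grad_weak_grad:
  assumes "has_weak_grad u G"
  shows "has_weak_grad u (weak_grad u)"
  unfolding weak_grad_def using someI[of "has_weak_grad u" G] assms by simp

lemma H1_locD:
  assumes "u \<in> H1_loc"
  shows "u \<in> L2_loc" "weak_grad u \<in> L2_loc" "has_weak_grad u (weak_grad u)"
proof -
  obtain G where "G \<in> L2_loc" and G: "has_weak_grad u G" and "u \<in> L2_loc"
    using assms by (auto simp: H1_loc_def)
  then show "u \<in> L2_loc" "has_weak_grad u (weak_grad u)"
    by (simp_all add: has_weak_grad_weak_grad)
  then show "weak_grad u \<in> L2_loc"
    using \<open>G \<in> L2_loc\<close> G has_weak_grad_unique L2_loc_AE_cong by blast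
qed

lemma has_weak_grad_add:
  assumes u: "has_weak_grad u G" and v: "has_weak_grad v H"
  shows "has_weak_grad (\<lambda>x. u x + v x) (\<lambda>x. G x + H x)"
proof (rule has_weak_gradI)
  note uv = has_weak_gradD[OF u] has_weak_gradD[OF v]
  show "(\<lambda>x. u x + v x) \<in> L1_loc" "(\<lambda>x. G x + H x) \<in> L1_loc"
    by (intro L1_loc_add uv)+
  fix \<eta> :: "real^'a \<Rightarrow> real" and i assume \<eta>: "\<eta> \<in> test_functions"
  have nth: "(\<lambda>x. G x $ i) \<in> L1_loc" "(\<lambda>x. H x $ i) \<in> L1_loc"
    by (intro L1_loc_bounded_linear[OF bounded_linear_vec_nth] uv)+
  note int = L1_loc_times_test_integrable[OF _ \<eta>]
    L1_loc_times_test_integrable[OF _ test_functions_partial_deriv[OF \<eta>]]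
  show "(LINT x|lebesgue. (u x + v x) * partial_deriv i \<eta> x) = - (LINT x|lebesgue. (G x + H x) $ i * \<eta> x)"
    unfolding vector_add_component distrib_right
    using uv(3,6)[OF \<eta>, of i]
    by (subst (1 2) Bochner_Integration.integral_add) (auto intro!: int nth uv(1,2,4,5))
qed

text \<open>Testing with \<open>f \<eta>\<close> instead of \<open>\<eta>\<close> in the definition of the weak gradient and using the
classical product rule moves the derivative of \<open>f\<close> to the right-hand side.\<close>

lemma has_weak_grad_mult_smooth:
  assumes u: "has_weak_grad u G" and f: "smooth f"
  shows "has_weak_grad (\<lambda>x. u x * f x) (\<lambda>x. f x *\<^sub>R G x + u x *\<^sub>R grad f x)"
proof (rule has_weak_gradI)
  note uG = has_weak_gradD[OF u]
  have "(\<lambda>x. f x * u x) \<in> L1_loc"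
    by (intro L1_loc_mult smooth_continuous_on f uG)
  then show "(\<lambda>x. u x * f x) \<in> L1_loc" by (simp add: mult.commute)
  show "(\<lambda>x. f x *\<^sub>R G x + u x *\<^sub>R grad f x) \<in> L1_loc"
    by (intro L1_loc_add L1_loc_scaleR L1_loc_scaleR_flip smooth_continuous_on continuous_on_grad f uG)
  fix \<eta> :: "real^'a \<Rightarrow> real" and i assume \<eta>: "\<eta> \<in> test_functions"
  have s: "smooth \<eta>" using \<eta> by (simp add: test_functions_iff)
  have Gi: "(\<lambda>x. G x $ i) \<in> L1_loc"
    by (intro L1_loc_bounded_linear[OF bounded_linear_vec_nth] uG)
  have 1: "integrable lebesgue (\<lambda>x. u x * (f x * partial_deriv i \<eta> x))"
    by (intro L1_loc_times_test_integrable test_functions_mult test_functions_partial_deriv f \<eta> uG)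
  have 2: "integrable lebesgue (\<lambda>x. u x * (partial_deriv i f x * \<eta> x))"
    by (intro L1_loc_times_test_integrable test_functions_mult smooth_partial_deriv f \<eta> uG)
  have 3: "integrable lebesgue (\<lambda>x. G x $ i * (f x * \<eta> x))"
    by (intro L1_loc_times_test_integrable test_functions_mult f \<eta> Gi)
  have "(LINT x|lebesgue. u x * partial_deriv i (\<lambda>x. f x * \<eta> x) x) = - (LINT x|lebesgue. G x $ i * (f x * \<eta> x))"
    by (rule uG(3)[OF test_functions_mult[OF f \<eta>]])
  moreover have "(LINT x|lebesgue. u x * partial_deriv i (\<lambda>x. f x * \<eta> x) x)
      = (LINT x|lebesgue. u x * (f x * partial_deriv i \<eta> x)) + (LINT x|lebesgue. u x * (partial_deriv i f x * \<eta> x))"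
    unfolding partial_deriv_mult[OF smooth_differentiable[OF f] smooth_differentiable[OF s]] distrib_left
    by (rule Bochner_Integration.integral_add[OF 1 2])
  moreover have "(LINT x|lebesgue. (f x *\<^sub>R G x + u x *\<^sub>R grad f x) $ i * \<eta> x)
      = (LINT x|lebesgue. G x $ i * (f x * \<eta> x) + u x * (partial_deriv i f x * \<eta> x))"
    by (simp add: grad_def algebra_simps)
  moreover have "\<dots> = (LINT x|lebesgue. G x $ i * (f x * \<eta> x)) + (LINT x|lebesgue. u x * (partial_deriv i f x * \<eta> x))"
    by (rule Bochner_Integration.integral_add[OF 3 2])
  ultimately show "(LINT x|lebesgue. u x * f x * partial_deriv i \<eta> x)
      = - (LINT x|lebesgue. (f x *\<^sub>R G x + u x *\<^sub>R grad f x) $ i * \<eta> x)"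
    by (simp add: mult.assoc)
qed

lemma has_weak_grad_sum:
  fixes u :: "'i \<Rightarrow> real^'d \<Rightarrow> real"
  assumes "\<And>i. i \<in> I \<Longrightarrow> has_weak_grad (u i) (G i)"
  shows "has_weak_grad (\<lambda>x. \<Sum>i\<in>I. u i x) (\<lambda>x. \<Sum>i\<in>I. G i x)"
proof -
  have "grad (\<lambda>x::real^'d. 0) = (\<lambda>x. 0)" by (simp add: grad_def partial_deriv_const vec_eq_iff fun_eq_iff)
  moreover have "has_weak_grad (\<lambda>x::real^'d. 0) (grad (\<lambda>x. 0))"
    by (intro has_weak_grad_smooth smooth_const)
  ultimately have "has_weak_grad (\<lambda>x::real^'d. 0) (\<lambda>x. 0)" by simp
  then show ?thesis
    using assms by (induction I rule: infinite_finite_induct) (simp_all, rule has_weak_grad_add, simp_all)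
qed

section \<open>Distributional divergences\<close>

lemma L1_loc_vec:
  fixes F :: "real^'d \<Rightarrow> real^'n"
  assumes "\<And>i. (\<lambda>x. F x $ i) \<in> L1_loc"
  shows "F \<in> L1_loc"
proof -
  have "(\<lambda>x. \<Sum>i\<in>UNIV. F x $ i *\<^sub>R axis i (1::real)) \<in> L1_loc"
    by (intro L1_loc_sum L1_loc_scaleR_flip continuous_on_const assms)
  moreover have "(\<Sum>i\<in>UNIV. F x $ i *\<^sub>R axis i 1) = F x" for x
    using basis_expansion[of "F x"] by (simp add: scalar_mult_eq_scaleR)
  ultimately show ?thesis by simp
qed

lemma L1_loc_matrix_mult_continuous:
  fixes v :: "real^'d \<Rightarrow> real^'m"
  assumes s: "\<And>j l. s j l \<in> L1_loc" and v: "continuous_on UNIV v"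
  shows "(\<lambda>x. (\<chi> j l. s j l x) *v v x) \<in> L1_loc"
proof (rule L1_loc_vec)
  fix j
  have "(\<lambda>x. \<Sum>l\<in>UNIV. v x $ l * s j l x) \<in> L1_loc"
    by (intro L1_loc_sum L1_loc_mult continuous_on_component v s)
  then show "(\<lambda>x. ((\<chi> j l. s j l x) *v v x) $ j) \<in> L1_loc"
    by (simp add: matrix_vector_mult_def mult.commute)
qed

lemma L1_loc_inner_grad_integrable:
  assumes F: "F \<in> L1_loc" and \<eta>: "\<eta> \<in> test_functions"
  shows "integrable lebesgue (\<lambda>x. F x \<bullet> grad \<eta> x)"
  using \<eta>
proof (rule test_functionsE)
  fix K assume \<eta>: "smooth \<eta>" and K: "compact K" and off: "\<And>x. x \<notin> K \<Longrightarrow> grad \<eta> x = 0"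
  show ?thesis
  proof (rule L1_loc_integrable[OF _ K])
    show "(\<lambda>x. F x \<bullet> grad \<eta> x) \<in> L1_loc"
      by (rule L1_loc_inner_flip[OF continuous_on_grad[OF \<eta>] F])
  qed (simp add: off)
qed

lemma weak_div_add:
  assumes "F \<in> L1_loc" "G \<in> L1_loc" "\<eta> \<in> test_functions"
  shows "weak_div (\<lambda>x. F x + G x) \<eta> = weak_div F \<eta> + weak_div G \<eta>"
  unfolding weak_div_def inner_add_left
  by (subst Bochner_Integration.integral_add) (simp_all add: L1_loc_inner_grad_integrable assms)

lemma weak_div_sum:
  assumes "\<And>i. i \<in> I \<Longrightarrow> F i \<in> L1_loc" "\<eta> \<in> test_functions"
  shows "weak_div (\<lambda>x. \<Sum>i\<in>I. F i x) \<eta> = (\<Sum>i\<in>I. weak_div (F i) \<eta>)"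
  unfolding weak_div_def inner_sum_left
  by (subst Bochner_Integration.integral_sum) (simp_all add: L1_loc_inner_grad_integrable assms sum_negf)

lemma weak_div_cong_AE:
  assumes "F \<in> L1_loc" "G \<in> L1_loc" "\<eta> \<in> test_functions" "AE x in lebesgue. F x = G x"
  shows "weak_div F \<eta> = weak_div G \<eta>"
proof -
  have "(LINT x|lebesgue. F x \<bullet> grad \<eta> x) = (LINT x|lebesgue. G x \<bullet> grad \<eta> x)"
  proof (rule integral_cong_AE)
    show "(\<lambda>x. F x \<bullet> grad \<eta> x) \<in> borel_measurable lebesgue" "(\<lambda>x. G x \<bullet> grad \<eta> x) \<in> borel_measurable lebesgue"
      using L1_loc_inner_grad_integrable assms by (blast intro: borel_measurable_integrable)+
    show "AE x in lebesgue. F x \<bullet> grad \<eta> x = G x \<bullet> grad \<eta> x"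
      using assms(4) by eventually_elim simp
  qed
  then show ?thesis by (simp add: weak_div_def)
qed

text \<open>Integrating by parts back onto the smooth function \<open>P\<close> produces the constant-coefficient
second-order operator applied to \<open>P\<close>.\<close>

lemma weak_div_harmonic_eq_0:
  assumes P: "P \<in> harmonic_polynomials A k" and \<eta>: "\<eta> \<in> test_functions"
  shows "weak_div (\<lambda>x. A *v grad P x) \<eta> = 0"
proof -
  have sP: "smooth (partial_deriv j P)" for j
    using P by (auto simp: harmonic_polynomials_def intro: smooth_partial_deriv smooth_homogeneous_polynomial)
  have int1: "integrable lebesgue (\<lambda>x. A $ i $ j * (partial_deriv j P x * partial_deriv i \<eta> x))" for i j
    by (intro integrable_mult_right L1_loc_times_test_integrable L1_loc_continuous smooth_continuous_on sP
        test_functions_partial_deriv \<eta>)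
  have int2: "integrable lebesgue (\<lambda>x. A $ i $ j * (partial_deriv i (partial_deriv j P) x * \<eta> x))" for i j
    by (intro integrable_mult_right L1_loc_times_test_integrable L1_loc_continuous smooth_continuous_on
        smooth_partial_deriv sP \<eta>)
  have "(LINT x|lebesgue. (A *v grad P x) \<bullet> grad \<eta> x)
      = (LINT x|lebesgue. (\<Sum>i\<in>UNIV. \<Sum>j\<in>UNIV. A $ i $ j * (partial_deriv j P x * partial_deriv i \<eta> x)))"
    by (simp add: inner_vec_def matrix_vector_mult_def grad_def sum_distrib_right mult.assoc)
  also have "\<dots> = (\<Sum>i\<in>UNIV. \<Sum>j\<in>UNIV. A $ i $ j * (LINT x|lebesgue. partial_deriv j P x * partial_deriv i \<eta> x))"
    using int1 by (simp add: Bochner_Integration.integral_sum Bochner_Integration.integrable_sum)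
  also have "\<dots> = (\<Sum>i\<in>UNIV. \<Sum>j\<in>UNIV. - (A $ i $ j * (LINT x|lebesgue. partial_deriv i (partial_deriv j P) x * \<eta> x)))"
    using has_weak_gradD(3)[OF has_weak_grad_smooth[OF sP] \<eta>] by (simp add: grad_def)
  also have "\<dots> = - (LINT x|lebesgue. (\<Sum>i\<in>UNIV. \<Sum>j\<in>UNIV. A $ i $ j * (partial_deriv i (partial_deriv j P) x * \<eta> x)))"
    using int2 by (simp add: Bochner_Integration.integral_sum Bochner_Integration.integrable_sum sum_negf)
  also have "\<dots> = - (LINT x|lebesgue. (\<Sum>i\<in>UNIV. \<Sum>j\<in>UNIV. A $ i $ j * partial_deriv i (partial_deriv j P) x) * \<eta> x)"
    by (simp add: sum_distrib_right mult.assoc)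
  also have "\<dots> = 0"
    using P by (simp add: harmonic_polynomials_def)
  finally show ?thesis by (simp add: weak_div_def)
qed

text \<open>Since \<open>q\<^sub>j = \<partial>\<^sub>l s\<^sub>j\<^sub>l\<close>, testing the potential equation for row \<open>j\<close> with \<open>f \<partial>\<^sub>j \<eta>\<close>
and summing turns \<open>\<integral> f q \<bullet> \<nabla>\<eta>\<close> into \<open>- \<integral> s\<^sub>j\<^sub>l \<partial>\<^sub>l (f \<partial>\<^sub>j \<eta>)\<close>. The part in which the derivative falls on \<open>\<partial>\<^sub>j \<eta>\<close>
contracts an antisymmetric with a symmetric matrix and disappears. What remains is
\<open>- \<integral> s\<^sub>j\<^sub>l \<partial>\<^sub>l f \<partial>\<^sub>j \<eta>\<close>, the divergence of \<open>s \<nabla>f\<close> tested with \<open>\<eta>\<close>.\<close>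

lemma weak_div_potential:
  fixes s :: "'d \<Rightarrow> 'd \<Rightarrow> real^'d \<Rightarrow> real" and q :: "real^'d \<Rightarrow> real^'d"
  assumes s: "\<And>j l. s j l \<in> L1_loc" and q: "q \<in> L1_loc"
    and anti: "\<And>j l. AE x in lebesgue. s j l x = - s l j x"
    and pot: "\<And>j \<eta>. \<eta> \<in> test_functions \<Longrightarrow> weak_div (\<lambda>x. \<chi> l. s j l x) \<eta> = (LINT x|lebesgue. q x $ j * \<eta> x)"
    and f: "smooth f" and \<eta>: "\<eta> \<in> test_functions"
  shows "weak_div (\<lambda>x. f x *\<^sub>R q x) \<eta> = - weak_div (\<lambda>x. (\<chi> j l. s j l x) *v grad f x) \<eta>"
proof -
  let ?\<zeta> = "\<lambda>j x. f x * partial_deriv j \<eta> x"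
  have \<zeta>: "?\<zeta> j \<in> test_functions" for j
    by (intro test_functions_mult test_functions_partial_deriv f \<eta>)
  have s\<eta>: "smooth \<eta>" using \<eta> by (simp add: test_functions_iff)
  have qj: "(\<lambda>x. q x $ j) \<in> L1_loc" for j
    by (intro L1_loc_bounded_linear[OF bounded_linear_vec_nth] q)
  have sj: "(\<lambda>x. \<chi> l. s j l x) \<in> L1_loc" for j
    by (rule L1_loc_vec) (simp add: s)
  have int_s: "integrable lebesgue (\<lambda>x. (\<chi> l. s j l x) \<bullet> grad (?\<zeta> j) x)" for j
    by (intro L1_loc_inner_grad_integrable sj \<zeta>)
  have "(LINT x|lebesgue. (f x *\<^sub>R q x) \<bullet> grad \<eta> x) = (LINT x|lebesgue. (\<Sum>j\<in>UNIV. q x $ j * ?\<zeta> j x))"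
    by (simp add: inner_vec_def grad_def algebra_simps sum_distrib_left)
  also have "\<dots> = (\<Sum>j\<in>UNIV. LINT x|lebesgue. q x $ j * ?\<zeta> j x)"
    by (intro Bochner_Integration.integral_sum L1_loc_times_test_integrable qj \<zeta>)
  also have "\<dots> = (\<Sum>j\<in>UNIV. - (LINT x|lebesgue. (\<chi> l. s j l x) \<bullet> grad (?\<zeta> j) x))"
    by (intro sum.cong refl) (simp only: pot[OF \<zeta>, symmetric] weak_div_def)
  also have "\<dots> = - (LINT x|lebesgue. (\<Sum>j\<in>UNIV. (\<chi> l. s j l x) \<bullet> grad (?\<zeta> j) x))"
    unfolding sum_negf by (subst Bochner_Integration.integral_sum[OF int_s]) simp
  also have "(LINT x|lebesgue. (\<Sum>j\<in>UNIV. (\<chi> l. s j l x) \<bullet> grad (?\<zeta> j) x))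
      = (LINT x|lebesgue. ((\<chi> j l. s j l x) *v grad f x) \<bullet> grad \<eta> x)"
  proof (rule integral_cong_AE)
    show "(\<lambda>x. \<Sum>j\<in>UNIV. (\<chi> l. s j l x) \<bullet> grad (?\<zeta> j) x) \<in> borel_measurable lebesgue"
      by (intro borel_measurable_sum borel_measurable_integrable int_s)
    show "(\<lambda>x. ((\<chi> j l. s j l x) *v grad f x) \<bullet> grad \<eta> x) \<in> borel_measurable lebesgue"
      by (intro borel_measurable_integrable L1_loc_inner_grad_integrable L1_loc_matrix_mult_continuous
          s continuous_on_grad f \<eta>)
    have "AE x in lebesgue. \<forall>j\<in>UNIV. \<forall>l\<in>UNIV. s j l x = - s l j x"
      by (intro AE_finite_allI finite anti)
    then show "AE x in lebesgue. (\<Sum>j\<in>UNIV. (\<chi> l. s j l x) \<bullet> grad (?\<zeta> j) x)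
        = ((\<chi> j l. s j l x) *v grad f x) \<bullet> grad \<eta> x"
    proof eventually_elim
      case (elim x)
      let ?H = "\<Sum>j\<in>UNIV. \<Sum>l\<in>UNIV. s j l x * partial_deriv l (partial_deriv j \<eta>) x"
      have "?H = (\<Sum>j\<in>UNIV. \<Sum>l\<in>UNIV. s l j x * partial_deriv j (partial_deriv l \<eta>) x)"
        by (rule sum.swap)
      also have "\<dots> = (\<Sum>j\<in>UNIV. \<Sum>l\<in>UNIV. - (s j l x * partial_deriv l (partial_deriv j \<eta>) x))"
      proof (intro sum.cong refl)
        fix j l
        have "s l j x = - s j l x" using elim by blast
        then show "s l j x * partial_deriv j (partial_deriv l \<eta>) x = - (s j l x * partial_deriv l (partial_deriv j \<eta>) x)"
          using partial_deriv_commute[OF s\<eta>, of j l x] by simp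
      qed
      also have "\<dots> = - ?H" by (simp add: sum_negf)
      \<comment> \<open>\<open>?H\<close> equals its own negative\<close>
      finally have H: "?H = 0" by simp
      have "(\<Sum>j\<in>UNIV. (\<chi> l. s j l x) \<bullet> grad (?\<zeta> j) x)
          = (\<Sum>j\<in>UNIV. \<Sum>l\<in>UNIV. f x * (s j l x * partial_deriv l (partial_deriv j \<eta>) x)
              + s j l x * partial_deriv l f x * partial_deriv j \<eta> x)"
        unfolding inner_vec_def grad_def
          partial_deriv_mult[OF smooth_differentiable[OF f] smooth_differentiable[OF smooth_partial_deriv[OF s\<eta>]]]
        by (simp add: algebra_simps)
      also have "\<dots> = f x * ?H + (\<Sum>j\<in>UNIV. \<Sum>l\<in>UNIV. s j l x * partial_deriv l f x * partial_deriv j \<eta> x)"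
        by (simp only: sum.distrib sum_distrib_left)
      also have "\<dots> = ((\<chi> j l. s j l x) *v grad f x) \<bullet> grad \<eta> x"
        unfolding H by (simp add: inner_vec_def matrix_vector_mult_def grad_def sum_distrib_right)
      finally show ?case .
    qed
  qed
  finally show ?thesis by (simp add: weak_div_def)
qed

section \<open>The corrected polynomial\<close>

text \<open>The gradient named \<open>G\<close> is the one given by the product rule; it is locally square integrable
because \<open>P\<close> and its derivatives are continuous.\<close>

lemma two_scale_expansion_H1_loc:
  fixes \<phi> :: "'d \<Rightarrow> real^'d \<Rightarrow> real"
  assumes \<phi>: "\<And>i. \<phi> i \<in> H1_loc" and P: "smooth P" and \<psi>: "\<psi> \<in> H1_loc"
  defines "u \<equiv> \<lambda>x. P x + (\<Sum>i\<in>UNIV. \<phi> i x * partial_deriv i P x) + \<psi> x"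
    and "G \<equiv> \<lambda>x. grad P x
      + (\<Sum>i\<in>UNIV. partial_deriv i P x *\<^sub>R weak_grad (\<phi> i) x + \<phi> i x *\<^sub>R grad (partial_deriv i P) x)
      + weak_grad \<psi> x"
  shows "u \<in> H1_loc" "has_weak_grad u G"
proof -
  have dP: "smooth (partial_deriv i P)" for i by (rule smooth_partial_deriv[OF P])
  show G: "has_weak_grad u G"
    unfolding u_def G_def
    by (intro has_weak_grad_add has_weak_grad_sum has_weak_grad_mult_smooth has_weak_grad_smooth H1_locD \<phi> \<psi> P dP)
  have "(\<lambda>x. partial_deriv i P x *\<^sub>R \<phi> i x) \<in> L2_loc" for i
    by (intro L2_loc_scaleR smooth_continuous_on dP H1_locD \<phi>)
  then have "(\<lambda>x. \<phi> i x * partial_deriv i P x) \<in> L2_loc" for i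
    by (simp add: mult.commute)
  then have "u \<in> L2_loc"
    unfolding u_def
    by (intro L2_loc_add L2_loc_sum L2_loc_continuous[OF smooth_continuous_on[OF P]] H1_locD(1)[OF \<psi>])
  moreover have "G \<in> L2_loc"
    unfolding G_def
    by (intro L2_loc_add L2_loc_sum L2_loc_scaleR[OF smooth_continuous_on[OF dP]]
        L2_loc_scaleR_flip[OF continuous_on_grad[OF dP]] L2_loc_continuous[OF continuous_on_grad[OF P]]
        H1_locD(1,2)[OF \<phi>] H1_locD(2)[OF \<psi>])
  ultimately show "u \<in> H1_loc" using G by (auto simp: H1_loc_def)
qed

lemma grad_eq_sum_axis: "grad P x = (\<Sum>i\<in>UNIV. partial_deriv i P x *\<^sub>R axis i 1)"
  using basis_expansion[of "grad P x"] by (simp add: grad_def scalar_mult_eq_scaleR)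

text \<open>The algebra behind the theorem at one point. The terms \<open>B *v grad P x\<close> and
\<open>S i *v grad (partial_deriv i P) x\<close> are subtracted and added, with \<open>B\<close> in the role of the
homogenized matrix and \<open>S i\<close> in that of the potential, in order to bring out the combinations
that the equations control.\<close>

lemma matrix_mult_two_scale_gradient:
  fixes A :: "real^'d^'d" and S :: "'d \<Rightarrow> real^'d^'d"
  shows "A *v (grad P x
      + (\<Sum>i\<in>UNIV. partial_deriv i P x *\<^sub>R g i + \<phi> i *\<^sub>R grad (partial_deriv i P) x) + h)
    = (\<Sum>i\<in>UNIV. partial_deriv i P x *\<^sub>R (A *v (axis i 1 + g i) - B *v axis i 1))
      + B *v grad P x
      + (\<Sum>i\<in>UNIV. S i *v grad (partial_deriv i P) x)
      + (\<Sum>i\<in>UNIV. (\<phi> i *\<^sub>R A - S i) *v grad (partial_deriv i P) x)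
      + A *v h"
proof -
  have lin: "C *v (\<Sum>i\<in>UNIV. v i) = (\<Sum>i\<in>UNIV. C *v v i)" for C :: "real^'d^'d" and v :: "'d \<Rightarrow> real^'d"
    by (rule linear_sum[OF matrix_vector_mul_linear])
  have sc: "C *v (r *\<^sub>R v) = r *\<^sub>R (C *v v)" for C :: "real^'d^'d" and r and v :: "real^'d"
    by (rule linear_scale[OF matrix_vector_mul_linear])
  have sc': "(r *\<^sub>R C) *v v = r *\<^sub>R (C *v v)" for C :: "real^'d^'d" and r and v :: "real^'d"
    by (rule scaleR_matrix_vector_assoc[symmetric])
  show ?thesis
    unfolding grad_eq_sum_axis[of P] matrix_vector_right_distrib matrix_vector_mult_diff_rdistrib lin sc sc'
    by (simp add: sum.distrib sum_subtractf scaleR_diff_right scaleR_add_right)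
qed

theorem proposition2:
  fixes lam :: real
    and a :: "real^'d \<Rightarrow> real^'d^'d"
    and ahom :: "real^'d^'d"
    and \<phi> :: "'d \<Rightarrow> real^'d \<Rightarrow> real"
    and \<sigma> :: "'d \<Rightarrow> 'd \<Rightarrow> 'd \<Rightarrow> real^'d \<Rightarrow> real"
    and k :: nat
    and P \<psi> :: "real^'d \<Rightarrow> real"
  assumes "CARD('d) \<ge> 2"
    and "k \<ge> 2"
    and "lam > 0"
    and "elliptic_field lam a"
    and "elliptic_matrix ahom"
    and "is_corrector a \<phi>"
    and "is_vector_potential a ahom \<phi> \<sigma>"
    and "P \<in> harmonic_polynomials ahom k"
    and "\<psi> \<in> H1_loc"
    and "\<forall>\<eta>\<in>test_functions.
           - weak_div (\<lambda>x. a x *v weak_grad \<psi> x) \<eta>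
             = weak_div (\<lambda>x. \<Sum>i\<in>UNIV.
                 (\<phi> i x *\<^sub>R a x - (\<chi> j l. \<sigma> i j l x)) *v grad (partial_deriv i P) x) \<eta>"
  shows "(\<lambda>x. P x + (\<Sum>i\<in>UNIV. \<phi> i x * partial_deriv i P x) + \<psi> x) \<in> H1_loc \<and>
         (\<forall>\<eta>\<in>test_functions.
           - weak_div (\<lambda>x. a x *v
               weak_grad (\<lambda>y. P y + (\<Sum>i\<in>UNIV. \<phi> i y * partial_deriv i P y) + \<psi> y) x) \<eta> = 0)"
proof
  let ?u = "\<lambda>x. P x + (\<Sum>i\<in>UNIV. \<phi> i x * partial_deriv i P x) + \<psi> x"
  let ?G = "\<lambda>x. grad P x
      + (\<Sum>i\<in>UNIV. partial_deriv i P x *\<^sub>R weak_grad (\<phi> i) x + \<phi> i x *\<^sub>R grad (partial_deriv i P) x)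
      + weak_grad \<psi> x"
  let ?q = "\<lambda>i x. corrector_flux a \<phi> i x - ahom *v axis i 1"
  let ?S = "\<lambda>i x. (\<chi> j l. \<sigma> i j l x) *v grad (partial_deriv i P) x"
  let ?R = "\<lambda>i x. (\<phi> i x *\<^sub>R a x - (\<chi> j l. \<sigma> i j l x)) *v grad (partial_deriv i P) x"
  note ell = \<open>elliptic_field lam a\<close>
  have P: "smooth P"
    using \<open>P \<in> harmonic_polynomials ahom k\<close> smooth_homogeneous_polynomial
    by (auto simp: harmonic_polynomials_def)
  then have dP: "smooth (partial_deriv i P)" for i by (rule smooth_partial_deriv)
  have \<phi>: "\<phi> i \<in> H1_loc" for i using \<open>is_corrector a \<phi>\<close> by (simp add: is_corrector_def)
  note \<psi> = \<open>\<psi> \<in> H1_loc\<close>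
  show u: "?u \<in> H1_loc" by (rule two_scale_expansion_H1_loc[OF \<phi> P \<psi>])
  have G: "has_weak_grad ?u ?G" by (rule two_scale_expansion_H1_loc[OF \<phi> P \<psi>])
  have \<sigma>: "\<sigma> i j l \<in> L1_loc" for i j l
    using \<open>is_vector_potential a ahom \<phi> \<sigma>\<close> by (simp add: is_vector_potential_def H1_locD(1) L2_loc_L1_loc)
  have q: "?q i \<in> L1_loc" for i
  proof -
    have "(\<lambda>x. a x *v (axis i 1 + weak_grad (\<phi> i) x) + - (ahom *v axis i 1)) \<in> L1_loc"
      by (intro L1_loc_add L1_loc_elliptic_field[OF ell] L1_loc_continuous continuous_on_const
          L2_loc_L1_loc H1_locD \<phi>)
    then show ?thesis by (simp add: corrector_flux_def)
  qed
  have S: "?S i \<in> L1_loc" for i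
    by (intro L1_loc_matrix_mult_continuous \<sigma> continuous_on_grad dP)
  have R: "?R i \<in> L1_loc" for i
  proof -
    have "(\<lambda>x. a x *v (\<phi> i x *\<^sub>R grad (partial_deriv i P) x) + (-1) *\<^sub>R ?S i x) \<in> L1_loc"
      by (intro L1_loc_add L1_loc_elliptic_field[OF ell] L1_loc_scaleR_flip L1_loc_scaleR continuous_on_const
          continuous_on_grad L2_loc_L1_loc H1_locD \<phi> dP S)
    then show ?thesis
      by (simp add: matrix_vector_mult_diff_rdistrib scaleR_matrix_vector_assoc[symmetric]
          linear_scale[OF matrix_vector_mul_linear])
  qed
  have L1: "(\<lambda>x. \<Sum>i\<in>UNIV. partial_deriv i P x *\<^sub>R ?q i x) \<in> L1_loc"
    "(\<lambda>x. ahom *v grad P x) \<in> L1_loc"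
    "(\<lambda>x. \<Sum>i\<in>UNIV. ?S i x) \<in> L1_loc"
    "(\<lambda>x. \<Sum>i\<in>UNIV. ?R i x) \<in> L1_loc"
    "(\<lambda>x. a x *v weak_grad \<psi> x) \<in> L1_loc"
    by (intro L1_loc_sum L1_loc_scaleR smooth_continuous_on dP q S R
        L1_loc_bounded_linear[OF matrix_vector_mul_bounded_linear] L1_loc_continuous continuous_on_grad P
        L1_loc_elliptic_field[OF ell] L2_loc_L1_loc H1_locD \<psi>)+
  have flux: "a x *v ?G x = (\<Sum>i\<in>UNIV. partial_deriv i P x *\<^sub>R ?q i x) + ahom *v grad P x
      + (\<Sum>i\<in>UNIV. ?S i x) + (\<Sum>i\<in>UNIV. ?R i x) + a x *v weak_grad \<psi> x" for x
    unfolding corrector_flux_def by (rule matrix_mult_two_scale_gradient)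
  have aG: "(\<lambda>x. a x *v ?G x) \<in> L1_loc"
    by (intro L1_loc_elliptic_field[OF ell] has_weak_gradD(2)[OF G])
  show "\<forall>\<eta>\<in>test_functions. - weak_div (\<lambda>x. a x *v weak_grad ?u x) \<eta> = 0"
  proof
    fix \<eta> :: "real^'d \<Rightarrow> real" assume \<eta>: "\<eta> \<in> test_functions"
    have "weak_div (\<lambda>x. a x *v weak_grad ?u x) \<eta> = weak_div (\<lambda>x. a x *v ?G x) \<eta>"
    proof (rule weak_div_cong_AE[OF _ aG \<eta>])
      show "(\<lambda>x. a x *v weak_grad ?u x) \<in> L1_loc"
        by (intro L1_loc_elliptic_field[OF ell] L2_loc_L1_loc H1_locD u)
      show "AE x in lebesgue. a x *v weak_grad ?u x = a x *v ?G x"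
        using has_weak_grad_unique[OF H1_locD(3)[OF u] G] by eventually_elim simp
    qed
    also have "\<dots> = weak_div (\<lambda>x. \<Sum>i\<in>UNIV. partial_deriv i P x *\<^sub>R ?q i x) \<eta>
        + weak_div (\<lambda>x. ahom *v grad P x) \<eta> + weak_div (\<lambda>x. \<Sum>i\<in>UNIV. ?S i x) \<eta>
        + weak_div (\<lambda>x. \<Sum>i\<in>UNIV. ?R i x) \<eta> + weak_div (\<lambda>x. a x *v weak_grad \<psi> x) \<eta>"
      unfolding flux by (simp only: weak_div_add L1_loc_add L1 \<eta>)
    also have "weak_div (\<lambda>x. \<Sum>i\<in>UNIV. partial_deriv i P x *\<^sub>R ?q i x) \<eta> = - weak_div (\<lambda>x. \<Sum>i\<in>UNIV. ?S i x) \<eta>"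
    proof -
      have "weak_div (\<lambda>x. partial_deriv i P x *\<^sub>R ?q i x) \<eta> = - weak_div (?S i) \<eta>" for i
      proof (rule weak_div_potential[OF \<sigma> q _ _ dP \<eta>])
        show "AE x in lebesgue. \<sigma> i j l x = - \<sigma> i l j x" for j l
          using \<open>is_vector_potential a ahom \<phi> \<sigma>\<close> unfolding is_vector_potential_def by blast
        show "weak_div (\<lambda>x. \<chi> l. \<sigma> i j l x) \<zeta> = (LINT x|lebesgue. ?q i x $ j * \<zeta> x)"
          if "\<zeta> \<in> test_functions" for j \<zeta>
          using \<open>is_vector_potential a ahom \<phi> \<sigma>\<close> that unfolding is_vector_potential_def by blast
      qed
      moreover have "(\<lambda>x. partial_deriv i P x *\<^sub>R ?q i x) \<in> L1_loc" for i
        by (intro L1_loc_scaleR smooth_continuous_on dP q)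
      ultimately show ?thesis
        by (simp add: weak_div_sum S \<eta> sum_negf)
    qed
    also have "weak_div (\<lambda>x. ahom *v grad P x) \<eta> = 0"
      by (rule weak_div_harmonic_eq_0[OF \<open>P \<in> harmonic_polynomials ahom k\<close> \<eta>])
    also have "weak_div (\<lambda>x. a x *v weak_grad \<psi> x) \<eta> = - weak_div (\<lambda>x. \<Sum>i\<in>UNIV. ?R i x) \<eta>"
      using assms(10) \<eta> by fastforce
    finally show "- weak_div (\<lambda>x. a x *v weak_grad ?u x) \<eta> = 0" by simp
  qed
qed

end
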